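(* Let $[a,b]$ be a non-trivial segment of $\mathbb{T}$ and let $\omega=\mathbb{R}\times(\mathbb{T}\setminus[a,b])$. The Grushin equation on $\mathbb{R}\times\mathbb{T}$ is not null-controllable on $\omega$ in time $T$, for any $T>0$.
   Context: $\mathbb{T}=\mathbb{R}/2\pi\mathbb{Z}$. The Grushin equation on $\mathbb{R}\times\mathbb{T}$ is null-controllable on an open set $\omega\subset\mathbb{R}\times\mathbb{T}$ in time $T>0$ if for all $f_0\in L^2(\mathbb{R}\times\mathbb{T})$ there exists $u\in L^2([0,T]\times\omega)$ such that the solution $f$, with $f(t,\cdot,\cdot)\in L^2(\mathbb{R}\times\mathbb{T})$ for $t\in[0,T]$, of $$(\partial_t-\partial_x^2-x^2\partial_y^2)f(t,x,y)=\mathbf 1_\omega u(t,x,y)\quad(t\in[0,T],\ (x,y)\in\mathbb{R}\times\mathbb{T}),\qquad f(0,\cdot,\cdot)=f_0,$$ satisfies $f(T,\cdot,\cdot)=0$. *)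

theory Defs
  imports "HOL-Analysis.Analysis"
begin

text \<open>
  The torus \<open>\<real>/2\<pi>\<int>\<close> is handled through \<open>2\<pi>\<close>-periodicity: subsets of it and smooth functions on
  it are periodic subsets of, and periodic functions on, \<open>\<real>\<close>, whereas square-integrable functions,
  which only matter up to null sets, are functions on the fundamental domain \<open>[0,2\<pi>)\<close>.
\<close>

definition cyl_dom :: "(real \<times> real) set" where
  "cyl_dom = UNIV \<times> {0..<2 * pi}"

definition cyl :: "(real \<times> real) measure" where
  "cyl = restrict_space lborel cyl_dom"

text \<open>The (periodic) set of all real representatives of the image of \<open>[a,b]\<close> in the torus.\<close>

definition torus_segment :: "real \<Rightarrow> real \<Rightarrow> real set" where
  "torus_segment a b = {y. \<exists>k::int. y + 2 * pi * of_int k \<in> {a..b}}"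

definition L2 :: "'a measure \<Rightarrow> ('a \<Rightarrow> complex) set" where
  "L2 M = {f. f \<in> borel_measurable M \<and> integrable M (\<lambda>p. (norm (f p))\<^sup>2)}"

definition continuous_L2 :: "real \<Rightarrow> 'a measure \<Rightarrow> (real \<Rightarrow> 'a \<Rightarrow> complex) \<Rightarrow> bool" where
  "continuous_L2 T M f \<longleftrightarrow>
     (\<forall>t\<in>{0..T}. f t \<in> L2 M) \<and>
     (\<forall>t\<in>{0..T}. ((\<lambda>s. LINT p|M. (norm (f s p - f t p))\<^sup>2) \<longlongrightarrow> 0) (at t within {0..T}))"

definition dir_deriv :: "'a::real_normed_vector \<Rightarrow> ('a \<Rightarrow> 'b::real_normed_vector) \<Rightarrow> 'a \<Rightarrow> 'b" where
  "dir_deriv v f p = frechet_derivative f (at p) v"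

primrec C_k :: "nat \<Rightarrow> ('a::real_normed_vector \<Rightarrow> 'b::real_normed_vector) \<Rightarrow> bool" where
  "C_k 0 f \<longleftrightarrow> continuous_on UNIV f"
| "C_k (Suc k) f \<longleftrightarrow> (\<forall>p. f differentiable (at p)) \<and> (\<forall>v. C_k k (dir_deriv v f))"

definition smooth :: "('a::real_normed_vector \<Rightarrow> 'b::real_normed_vector) \<Rightarrow> bool" where
  "smooth f \<longleftrightarrow> (\<forall>k. C_k k f)"

text \<open>
  Points of space-time are written \<open>(t, x, y)\<close>. Test functions need not vanish at the initial and
  final times, and are compactly supported in space.
\<close>

definition test_function :: "(real \<times> real \<times> real \<Rightarrow> complex) \<Rightarrow> bool" where
  "test_function \<phi> \<longleftrightarrow>
     smooth \<phi> \<and>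
     (\<forall>t x y. \<phi> (t, x, y + 2 * pi) = \<phi> (t, x, y)) \<and>
     (\<exists>R. \<forall>t x y. \<bar>x\<bar> > R \<longrightarrow> \<phi> (t, x, y) = 0)"

abbreviation d_t :: "(real \<times> real \<times> real \<Rightarrow> complex) \<Rightarrow> real \<times> real \<times> real \<Rightarrow> complex" where
  "d_t \<equiv> dir_deriv (1, 0, 0)"

abbreviation d_x :: "(real \<times> real \<times> real \<Rightarrow> complex) \<Rightarrow> real \<times> real \<times> real \<Rightarrow> complex" where
  "d_x \<equiv> dir_deriv (0, 1, 0)"

abbreviation d_y :: "(real \<times> real \<times> real \<Rightarrow> complex) \<Rightarrow> real \<times> real \<times> real \<Rightarrow> complex" where
  "d_y \<equiv> dir_deriv (0, 0, 1)"

text \<open>The formal transpose \<open>-\<partial>\<^sub>t - \<partial>\<^sub>x\<^sup>2 - x\<^sup>2 \<partial>\<^sub>y\<^sup>2\<close> of the operator \<open>\<partial>\<^sub>t - \<partial>\<^sub>x\<^sup>2 - x\<^sup>2 \<partial>\<^sub>y\<^sup>2\<close>.\<close>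

definition grushin_adjoint ::
    "(real \<times> real \<times> real \<Rightarrow> complex) \<Rightarrow> real \<times> real \<times> real \<Rightarrow> complex" where
  "grushin_adjoint \<phi> = (\<lambda>(t, x, y).
     - d_t \<phi> (t, x, y) - d_x (d_x \<phi>) (t, x, y) - of_real (x\<^sup>2) * d_y (d_y \<phi>) (t, x, y))"

text \<open>The measure space \<open>[0,T] \<times> \<omega>\<close>, for a periodic set \<open>\<omega>\<close>.\<close>

definition control_space :: "real \<Rightarrow> (real \<times> real) set \<Rightarrow> (real \<times> real \<times> real) measure" where
  "control_space T \<omega> = restrict_space lborel ({0..T} \<times> (\<omega> \<inter> cyl_dom))"

text \<open>
  Solutions in \<open>C([0,T]; L\<^sup>2)\<close> in the sense of distributions, i.e. the equation is tested against
  smooth functions and integrated by parts on \<open>[0,t]\<close> for every \<open>t \<in> [0,T]\<close>.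
  The Grushin operator is essentially self-adjoint on compactly supported smooth functions, so
  there is exactly one such solution (the one given by the Duhamel formula) for all
  \<open>f\<^sub>0\<close> and \<open>u\<close> in \<open>L\<^sup>2\<close>.
\<close>

definition grushin_solution ::
    "(real \<times> real) set \<Rightarrow> real \<Rightarrow> (real \<times> real \<Rightarrow> complex) \<Rightarrow> (real \<times> real \<times> real \<Rightarrow> complex)
      \<Rightarrow> (real \<Rightarrow> real \<times> real \<Rightarrow> complex) \<Rightarrow> bool" where
  "grushin_solution \<omega> T f0 u f \<longleftrightarrow>
     continuous_L2 T cyl f \<and>
     (AE p in cyl. f 0 p = f0 p) \<and>
     (\<forall>\<phi>. test_function \<phi> \<longrightarrow> (\<forall>t\<in>{0..T}.
        (LINT p|cyl. f t p * \<phi> (t, p)) - (LINT p|cyl. f0 p * \<phi> (0, p))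
          + (LINT s:{0..t}|lborel. (LINT p|cyl. f s p * grushin_adjoint \<phi> (s, p)))
        = (LINT q|control_space t \<omega>. u q * \<phi> q)))"

definition grushin_null_controllable :: "(real \<times> real) set \<Rightarrow> real \<Rightarrow> bool" where
  "grushin_null_controllable \<omega> T \<longleftrightarrow>
     (\<forall>f0 \<in> L2 cyl. \<exists>u \<in> L2 (control_space T \<omega>). \<exists>f.
        grushin_solution \<omega> T f0 u f \<and> (AE p in cyl. f T p = 0))"

end

theory Submission
  imports Defs "HOL-Complex_Analysis.Complex_Analysis" "HOL-Probability.Distributions"
begin

text \<open>
  If \<open>p\<close> is a polynomial with \<open>p(0) = 0\<close>, then \<open>p(w)\<close> with \<open>w = exp (t - T - x\<^sup>2/2 + \<i>(y - c))\<close>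
  solves the adjoint equation. Testing a controlled solution against it expresses the pairing of the
  initial datum with \<open>p(w)\<close> at time 0 through the control and the values of \<open>p\<close> on
  the set \<open>K\<close> of all \<open>w\<close> with \<open>y\<close> outside of \<open>[a,b]\<close>, which lies in the unit disc minus a sector.
  By Cauchy's formula the datum \<open>w / (w - \<rho>)\<close>, cut off to \<open>\<bar>x\<bar> \<le> 1\<close>, has pairing proportional to \<open>p(\<rho>)\<close>.
  Here \<open>\<rho>\<close> is a small positive number in the sector, so there is a polynomial \<open>P\<close> with
  \<open>\<bar>P\<bar> \<le> 1\<close> on \<open>K\<close> and \<open>\<bar>P(\<rho>)\<bar> > 1\<close>; the choices \<open>p(z) = z P(z)\<^sup>n\<close> give a contradiction.
  So already this single datum cannot be steered to 0.
\<close>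

subsection \<open>Polynomials peaking in a sector\<close>

lemma poly_bounded_unit_disc:
  fixes p :: "complex poly"
  obtains B where "B \<ge> 0" "\<And>z. norm z \<le> 1 \<Longrightarrow> norm (poly p z) \<le> B"
proof -
  have "bounded (poly p ` cball 0 1)"
    by (intro compact_imp_bounded compact_continuous_image continuous_intros compact_cball)
  then obtain B where "\<forall>v \<in> poly p ` cball 0 1. norm v \<le> B" unfolding bounded_iff by blast
  then have B: "norm (poly p z) \<le> B" if "norm z \<le> 1" for z using that by simp
  from order_trans[OF norm_ge_zero B[of 0]] B show ?thesis by (intro that) auto
qed

section \<open>Closure properties of uniform approximation by polynomials\<close>

definition poly_approximable :: "complex set \<Rightarrow> (complex \<Rightarrow> complex) \<Rightarrow> bool" where
  "poly_approximable K f \<longleftrightarrow> (\<forall>e>0. \<exists>p. \<forall>z\<in>K. norm (f z - poly p z) < e)"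

lemma poly_approximable_poly: "poly_approximable K (poly p)"
  unfolding poly_approximable_def by (auto intro: exI[of _ p])

lemma poly_approximable_const: "poly_approximable K (\<lambda>_. c)"
  unfolding poly_approximable_def by (auto intro!: exI[of _ "[:c:]"])

lemma poly_approximable_add:
  assumes "poly_approximable K f" "poly_approximable K g"
  shows "poly_approximable K (\<lambda>z. f z + g z)"
  unfolding poly_approximable_def
proof (intro allI impI)
  fix e :: real assume "e > 0"
  then have e: "e / 2 > 0" by simp
  obtain p where p: "\<And>z. z \<in> K \<Longrightarrow> norm (f z - poly p z) < e / 2"
    using assms(1) e unfolding poly_approximable_def by blast
  obtain q where q: "\<And>z. z \<in> K \<Longrightarrow> norm (g z - poly q z) < e / 2"
    using assms(2) e unfolding poly_approximable_def by blast
  have "norm (f z + g z - poly (p + q) z) < e" if "z \<in> K" for z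
    using norm_triangle_ineq[of "f z - poly p z" "g z - poly q z"] p[OF that] q[OF that]
    by (simp add: algebra_simps)
  then show "\<exists>p. \<forall>z\<in>K. norm (f z + g z - poly p z) < e" by blast
qed

lemma poly_approximable_mult:
  assumes f: "poly_approximable K f" and g: "poly_approximable K g"
    and bf: "\<And>z. z \<in> K \<Longrightarrow> norm (f z) \<le> B" and bg: "\<And>z. z \<in> K \<Longrightarrow> norm (g z) \<le> B"
  shows "poly_approximable K (\<lambda>z. f z * g z)"
  unfolding poly_approximable_def
proof (intro allI impI)
  fix e :: real assume "e > 0"
  define B' where "B' = \<bar>B\<bar> + 1"
  \<comment> \<open>The cap at 1 keeps the approximant of \<open>g\<close> below \<open>B'\<close>,
    so the product error is at most \<open>2 * B' * d\<close>; the extra 1 in the denominator makes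
    this strictly smaller than \<open>e\<close>.\<close>
  define d where "d = min 1 (e / (2 * B' + 1))"
  have B': "B' \<ge> 1" and d: "d > 0" "d \<le> 1" using \<open>e > 0\<close> by (auto simp: B'_def d_def)
  have "d * (2 * B' + 1) \<le> e" 
    using B' min.cobounded2[of 1 "e / (2 * B' + 1)"] unfolding d_def[symmetric]
    by (simp add: field_simps)
  then have de: "d * (2 * B') < e" using d by (simp add: algebra_simps)
  obtain p where p: "\<And>z. z \<in> K \<Longrightarrow> norm (f z - poly p z) < d"
    using f d(1) unfolding poly_approximable_def by blast
  obtain q where q: "\<And>z. z \<in> K \<Longrightarrow> norm (g z - poly q z) < d"
    using g d(1) unfolding poly_approximable_def by blast
  have "norm (f z * g z - poly (p * q) z) < e" if z: "z \<in> K" for z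
  proof -
    have "norm (poly q z) \<le> norm (g z) + norm (g z - poly q z)"
      by (metis norm_triangle_sub norm_minus_commute)
    also have "\<dots> \<le> B'" using bg[OF z] q[OF z] d by (simp add: B'_def)
    finally have Q: "norm (poly q z) \<le> B'" .
    have F: "norm (f z) \<le> B'" using bf[OF z] by (simp add: B'_def)
    have "f z * g z - poly (p * q) z = f z * (g z - poly q z) + (f z - poly p z) * poly q z"
      by (simp add: algebra_simps)
    then have "norm (f z * g z - poly (p * q) z)
        \<le> norm (f z) * norm (g z - poly q z) + norm (f z - poly p z) * norm (poly q z)"
      by (metis norm_mult norm_triangle_ineq)
    also have "\<dots> \<le> B' * d + d * B'"
      using F Q p[OF z] q[OF z] B' d by (intro add_mono mult_mono) auto
    finally show ?thesis using de by (simp add: algebra_simps)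
  qed
  then show "\<exists>p. \<forall>z\<in>K. norm (f z * g z - poly p z) < e" by blast
qed

lemma poly_approximable_uniform_limit:
  assumes "\<And>n. poly_approximable K (f n)"
    and "\<And>e. e > 0 \<Longrightarrow> \<exists>n. \<forall>z\<in>K. norm (g z - f n z) < e"
  shows "poly_approximable K g"
  unfolding poly_approximable_def
proof (intro allI impI)
  fix e :: real assume "e > 0"
  then have e: "e / 2 > 0" by simp
  obtain n where n: "\<And>z. z \<in> K \<Longrightarrow> norm (g z - f n z) < e / 2" using assms(2)[OF e] by blast
  obtain p where p: "\<And>z. z \<in> K \<Longrightarrow> norm (f n z - poly p z) < e / 2"
    using assms(1)[of n] e unfolding poly_approximable_def by blast
  have "norm (g z - poly p z) < e" if "z \<in> K" for z
    using norm_triangle_ineq[of "g z - f n z" "f n z - poly p z"] n[OF that] p[OF that] by simp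
  then show "\<exists>p. \<forall>z\<in>K. norm (g z - poly p z) < e" by blast
qed

text \<open>Partial sums of the geometric series converge uniformly: the remainder after
  \<open>n\<close> terms is \<open>u z ^ n / (1 - u z)\<close>, at most
  \<open>2 * (1/2) ^ n\<close>. This is the engine of the pole pushing below.\<close>

lemma poly_approximable_geometric:
  assumes u: "poly_approximable K u" and b: "\<And>z. z \<in> K \<Longrightarrow> norm (u z) \<le> 1 / 2"
  shows "poly_approximable K (\<lambda>z. 1 / (1 - u z))"
proof (rule poly_approximable_uniform_limit)
  have pow: "poly_approximable K (\<lambda>z. u z ^ n)" for n
  proof (induction n)
    case 0 show ?case by (simp add: poly_approximable_const)
  next
    case (Suc n)
    have "poly_approximable K (\<lambda>z. u z * u z ^ n)"
    proof (rule poly_approximable_mult[OF u Suc, where B = 1])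
      show "norm (u z) \<le> 1" if "z \<in> K" for z using b[OF that] by simp
      then show "norm (u z ^ n) \<le> 1" if "z \<in> K" for z
        using that by (simp add: norm_power power_le_one)
    qed
    then show ?case by simp
  qed
  show "poly_approximable K (\<lambda>z. \<Sum>k<n. u z ^ k)" for n
    by (induction n) (auto intro!: poly_approximable_const poly_approximable_add[OF _ pow])
  show "\<exists>n. \<forall>z\<in>K. norm (1 / (1 - u z) - (\<Sum>k<n. u z ^ k)) < e" if "e > 0" for e :: real
  proof -
    obtain n where n: "(1/2::real) ^ n < e / 2"
      using real_arch_pow_inv[of "e / 2" "1 / 2"] \<open>e > 0\<close> by auto
    have "norm (1 / (1 - u z) - (\<Sum>k<n. u z ^ k)) < e" if z: "z \<in> K" for z
    proof -
      have ne: "u z \<noteq> 1" using b[OF z] by auto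
      have "1 / (1 - u z) - (\<Sum>k<n. u z ^ k) = u z ^ n / (1 - u z)"
        using ne by (simp add: geometric_sum field_simps) 
      moreover have "norm (1 - u z) \<ge> 1 / 2"
        using norm_triangle_ineq2[of 1 "u z"] b[OF z] by simp
      moreover have "norm (u z ^ n) \<le> (1/2) ^ n"
        using b[OF z] by (simp add: norm_power power_mono)
      ultimately have "norm (1 / (1 - u z) - (\<Sum>k<n. u z ^ k)) \<le> (1/2) ^ n / (1/2)"
        by (simp only: norm_divide) (rule frac_le, auto)
      then show ?thesis using n by simp
    qed
    then show ?thesis by blast
  qed
qed

text \<open>Runge's pole pushing along the real axis: moving the pole by at most half of its distance
  to \<open>K\<close> amounts to a geometric series.\<close>

lemma poly_approximable_cauchy_kernel:
  assumes \<eta>: "\<eta> > 0" and K: "\<And>z. z \<in> K \<Longrightarrow> norm z \<le> 1"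
    and dist: "\<And>z s. z \<in> K \<Longrightarrow> s \<ge> w \<Longrightarrow> norm (z - of_real s) \<ge> \<eta>"
    and "w \<le> 2"
  shows "poly_approximable K (\<lambda>z. 1 / (z - of_real w))"
proof -
  \<comment> \<open>A pole at 2 is far enough from the unit disc for an expansion of the kernel in
    powers of \<open>z / 2\<close>.\<close>
  have kernel2: "poly_approximable K (\<lambda>z. 1 / (z - 2))"
  proof -
    have b: "norm (z / 2) \<le> 1 / 2" if "z \<in> K" for z using K[OF that] by (simp add: norm_divide)
    have "poly_approximable K (\<lambda>z. 1 / (1 - z / 2))"
    proof (rule poly_approximable_geometric[OF _ b])
      have "poly [:0, 1/2:] = (\<lambda>z::complex. z / 2)" by (simp add: fun_eq_iff)
      then show "poly_approximable K (\<lambda>z. z / 2)" using poly_approximable_poly[of K "[:0, 1/2:]"] by simp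
    qed
    then have "poly_approximable K (\<lambda>z. (-1/2) * (1 / (1 - z / 2)))"
    proof (rule poly_approximable_mult[OF poly_approximable_const, where B = 2])
      show "norm (1 / (1 - z / 2)) \<le> 2" if "z \<in> K" for z
        using b[OF that] norm_triangle_ineq2[of 1 "z / 2"] by (simp add: norm_divide divide_le_eq)
    qed (auto simp: norm_divide)
    moreover have "(-1/2) * (1 / (1 - z / 2)) = 1 / (z - 2)" for z :: complex
      by (cases "z = 2") (auto simp: field_simps)
    ultimately show ?thesis by simp
  qed
  \<comment> \<open>Writing g for the kernel at the old pole \<open>s\<close>, the kernel at
    \<open>s'\<close> equals g / (1 - (s' - s) g); a move by at most \<open>\<eta> / 2\<close> keeps
    the ratio (s' - s) g within 1/2.\<close>
  have step: "poly_approximable K (\<lambda>z. 1 / (z - of_real s'))"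
    if s: "poly_approximable K (\<lambda>z. 1 / (z - of_real s))" "s \<ge> w" "s' \<ge> w" "\<bar>s - s'\<bar> \<le> \<eta> / 2" for s s'
  proof -
    let ?g = "\<lambda>z. 1 / (z - complex_of_real s)"
    have g: "norm (?g z) \<le> 1 / \<eta>" if "z \<in> K" for z
      using dist[OF that \<open>s \<ge> w\<close>] \<eta> by (simp add: norm_divide frac_le)
    let ?B = "max (\<eta> / 2) (max (1 / \<eta>) 2)"
    have "norm (of_real (s' - s) * ?g z) \<le> (\<eta> / 2) * (1 / \<eta>)" if "z \<in> K" for z
      unfolding norm_mult using g[OF that] s(4) \<eta> by (intro mult_mono) (auto simp: abs_minus_commute simp flip: of_real_diff)
    then have b: "norm (of_real (s' - s) * ?g z) \<le> 1 / 2" if "z \<in> K" for z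
      using that \<eta> by fastforce
    have "poly_approximable K (\<lambda>z. of_real (s' - s) * ?g z)"
    proof (rule poly_approximable_mult[OF poly_approximable_const s(1), where B = ?B])
      show "norm (complex_of_real (s' - s)) \<le> ?B"
        unfolding norm_of_real using s(4) by linarith
      show "norm (?g z) \<le> ?B" if "z \<in> K" for z using g[OF that] by linarith
    qed
    then have q: "poly_approximable K (\<lambda>z. 1 / (1 - of_real (s' - s) * ?g z))"
      using b by (rule poly_approximable_geometric)
    have "poly_approximable K (\<lambda>z. ?g z * (1 / (1 - of_real (s' - s) * ?g z)))"
    proof (rule poly_approximable_mult[OF s(1) q, where B = ?B])
      show "norm (?g z) \<le> ?B" if "z \<in> K" for z using g[OF that] by simp
      have "norm (1 / (1 - of_real (s' - s) * ?g z)) \<le> 2" if "z \<in> K" for z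
      proof -
        have "norm (1 - of_real (s' - s) * ?g z) \<ge> 1 / 2"
          using b[OF that] norm_triangle_ineq2[of 1 "of_real (s' - s) * ?g z"] by simp
        then show ?thesis by (subst norm_divide) (simp add: divide_le_eq del: of_real_diff)
      qed
      then show "norm (1 / (1 - of_real (s' - s) * ?g z)) \<le> ?B" if "z \<in> K" for z
        using that by fastforce
    qed
    moreover have "?g z * (1 / (1 - of_real (s' - s) * ?g z)) = 1 / (z - of_real s')" if "z \<in> K" for z
    proof -
      have "z - of_real s \<noteq> 0" "z - of_real s' \<noteq> 0" using dist[OF that] s \<eta> by fastforce+
      then show ?thesis by (simp add: field_simps)
    qed
    ultimately show ?thesis unfolding poly_approximable_def by (simp cong: ball_cong)
  qed
  \<comment> \<open>The pole walks left from 2 in steps of \<open>\<eta> / 2\<close>; the maximum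
    stops it exactly at \<open>w\<close>, so it never leaves the ray on which the distance bound
    holds.\<close>
  have "poly_approximable K (\<lambda>z. 1 / (z - of_real (max w (2 - real n * (\<eta> / 2)))))" for n
  proof (induction n)
    case 0 show ?case using kernel2 \<open>w \<le> 2\<close> by simp
  next
    case (Suc n)
    have "real (Suc n) * (\<eta> / 2) = real n * (\<eta> / 2) + \<eta> / 2" by (simp add: algebra_simps)
    then show ?case by (intro step[OF Suc]) (use \<eta> in linarith)+
  qed
  moreover obtain n :: nat where "real n > (2 - w) / (\<eta> / 2)" using reals_Archimedean2 by blast
  then have "max w (2 - real n * (\<eta> / 2)) = w"
    using \<eta> by (simp add: field_simps max_def)
  ultimately show ?thesis by metis
qed

text \<open>A Cauchy kernel with its pole just to the right of \<open>\<rho>\<close> is at least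
  four times as large at \<open>\<rho>\<close> as anywhere on the disc without the sector. Pole
  pushing replaces it by a polynomial with an error small enough to keep a gap, and scaling places 1
  inside the gap.\<close>

lemma ex_poly_peak_outside_sector:
  fixes \<kappa> \<rho> :: real
  assumes \<kappa>: "0 \<le> \<kappa>" "\<kappa> < 1" and \<rho>: "0 < \<rho>" "\<rho> < 1"
  obtains P where "norm (poly P (of_real \<rho> :: complex)) > 1"
    and "\<And>z. norm z \<le> 1 \<Longrightarrow> Re z \<le> \<kappa> * norm z \<Longrightarrow> norm (poly P z) \<le> 1"
proof -
  define K where "K = {z. norm z \<le> 1 \<and> Re z \<le> \<kappa> * norm z}"
  \<comment> \<open>The distance from \<open>\<rho>\<close> to the complement of the sector: with
    \<open>\<kappa>\<close> the cosine of the half-angle, it is \<open>\<rho>\<close> times the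
    sine.\<close>
  define d where "d = \<rho> * sqrt (1 - \<kappa>\<^sup>2)"
  define \<eta> where "\<eta> = d / 4"
  define w where "w = \<rho> + \<eta>"
  have k2: "0 < 1 - \<kappa>\<^sup>2" "1 - \<kappa>\<^sup>2 \<le> 1" using \<kappa> by (auto simp: power_less_one_iff abs_square_less_1)
  then have d: "0 < d" "d \<le> \<rho>" using \<rho> by (auto simp: d_def mult_le_cancel_left1)
  have distK: "norm (z - of_real s) \<ge> d" if z: "z \<in> K" and s: "s \<ge> \<rho>" for z s
  proof -
    have "d\<^sup>2 \<le> s\<^sup>2 * (1 - \<kappa>\<^sup>2)"
      unfolding d_def using k2 s \<rho> by (simp add: power_mult_distrib mult_right_mono power_mono)
    \<comment> \<open>The square of \<open>norm z - s * \<kappa>\<close> is what separates the two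
      sides.\<close>
    also have "\<dots> \<le> (norm z)\<^sup>2 - 2 * s * (\<kappa> * norm z) + s\<^sup>2"
      using zero_le_power2[of "norm z - s * \<kappa>"] by (simp add: power2_eq_square algebra_simps)
    also have "\<dots> \<le> (norm z)\<^sup>2 - 2 * s * Re z + s\<^sup>2"
      using z s \<rho> by (simp add: K_def mult_left_mono)
    also have "\<dots> = (norm (z - of_real s))\<^sup>2"
      by (simp add: cmod_power2) (simp add: power2_eq_square algebra_simps)
    finally show ?thesis by (rule power2_le_imp_le) simp
  qed
  \<comment> \<open>The point \<open>\<rho>\<close> joins the set, since the polynomial must follow
    the kernel there too; the ray from \<open>w\<close> stays \<open>\<eta>\<close> away from
    \<open>\<rho>\<close> and \<open>d\<close> away from \<open>K\<close>.\<close>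
  have "poly_approximable (insert (of_real \<rho>) K) (\<lambda>z. 1 / (z - of_real w))"
  proof (rule poly_approximable_cauchy_kernel)
    show "\<eta> > 0" using d by (simp add: \<eta>_def)
    show "norm z \<le> 1" if "z \<in> insert (of_real \<rho>) K" for z using that \<rho> by (auto simp: K_def)
    show "w \<le> 2" using d \<rho> by (simp add: w_def \<eta>_def)
    show "norm (z - of_real s) \<ge> \<eta>" if "z \<in> insert (of_real \<rho>) K" "s \<ge> w" for z s
    proof -
      have s: "s \<ge> \<rho> + \<eta>" "\<eta> > 0" "\<eta> \<le> d" using that(2) d by (auto simp: w_def \<eta>_def)
      show ?thesis
      proof (cases "z = of_real \<rho>")
        case True
        then show ?thesis using s by (simp flip: of_real_diff)
      next
        case False
        then show ?thesis using distK[of z s] that(1) s by simp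
      qed
    qed
  qed
  then obtain Q where Q: "\<And>z. z \<in> insert (of_real \<rho>) K \<Longrightarrow> norm (1 / (z - of_real w) - poly Q z) < 1 / d"
    unfolding poly_approximable_def using d by (metis zero_less_divide_1_iff)
  show ?thesis
  proof
    \<comment> \<open>\<open>Q\<close> is below 2 / d on \<open>K\<close> and above 3 / d at
      \<open>\<rho>\<close>, so the factor d / 2 separates the values at 1.\<close>
    let ?P = "smult (of_real (d / 2)) Q"
    show "norm (poly ?P z) \<le> 1" if "norm z \<le> 1" "Re z \<le> \<kappa> * norm z" for z
    proof -
      have z: "z \<in> K" using that by (simp add: K_def)
      have "norm (1 / (z - of_real w)) \<le> 1 / d"
        using distK[OF z, of w] d by (simp add: norm_divide frac_le w_def \<eta>_def)
      then have "norm (poly Q z) < 2 / d"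
        using Q[of z] z norm_triangle_ineq2[of "poly Q z" "1 / (z - of_real w)"]
        by (simp add: norm_minus_commute field_simps)
      then show ?thesis using d by (simp add: norm_mult field_simps)
    qed
    have "norm (1 / (complex_of_real \<rho> - of_real w)) = 4 / d"
      using d by (simp add: norm_divide w_def \<eta>_def)
    then have "norm (poly Q (of_real \<rho>)) > 3 / d"
      using Q[of "of_real \<rho>"] norm_triangle_ineq2[of "1 / (complex_of_real \<rho> - of_real w)" "poly Q (of_real \<rho>)"]
      by (simp add: field_simps)
    then show "norm (poly ?P (of_real \<rho>)) > 1" using d by (simp add: norm_mult field_simps)
  qed
qed

subsection \<open>Smooth functions\<close>

text \<open>The factor \<open>poly q (1 / s)\<close> makes the classical flat function exp(-1/s)
  part of a family closed under differentiation, so one derivative rule serves all orders.\<close>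

definition flat :: "real poly \<Rightarrow> real \<Rightarrow> real" where
  "flat q s = (if s \<le> 0 then 0 else poly q (1 / s) * exp (- (1 / s)))"

text \<open>The chain rule in 1 / s: the inner derivative -1 / s^2 turns q' - q into q - q' and
  leaves the factor \<open>monom 1 2\<close>.\<close>

definition flat_deriv :: "real poly \<Rightarrow> real poly" where
  "flat_deriv q = (q - pderiv q) * monom 1 2"

lemma poly_div_exp_tendsto_0: "((\<lambda>x. poly q x * exp (- x)) \<longlongrightarrow> (0::real)) at_top"
proof -
  have "((\<lambda>x. \<Sum>i\<le>degree q. coeff q i * (x ^ i / exp x)) \<longlongrightarrow> (\<Sum>i\<le>degree q. coeff q i * 0)) at_top"
    by (intro tendsto_intros tendsto_power_div_exp_0)
  then show ?thesis
    by (simp add: poly_altdef sum_distrib_right exp_minus divide_inverse mult.assoc)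
qed

text \<open>Away from 0 this is the chain rule. At 0 the right difference quotient is a polynomial
  in 1 / h times exp(-1 / h), which tends to 0, and the left one vanishes.\<close>

lemma flat_has_real_derivative:
  "(flat q has_real_derivative flat (flat_deriv q) s) (at s)"
proof (cases s "0::real" rule: linorder_cases)
  case less
  have "((\<lambda>_. 0) has_real_derivative flat (flat_deriv q) s) (at s)" using less by (simp add: flat_def)
  then show ?thesis
    by (rule has_field_derivative_transform_within_open[of _ _ _ "{..<0}"]) (use less in \<open>auto simp: flat_def\<close>)
next
  case equal
  have lim: "((\<lambda>h. flat q h / h) \<longlongrightarrow> 0) (at_right 0)"
  proof -
    have "((\<lambda>h. poly (q * [:0,1:]) (inverse h) * exp (- inverse h)) \<longlongrightarrow> 0) (at_right (0::real))"
      by (rule filterlim_compose[OF poly_div_exp_tendsto_0 filterlim_inverse_at_top_right])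
    then show ?thesis
      by (rule Lim_transform_eventually)
        (rule eventually_mono[OF eventually_at_right_less], simp add: flat_def divide_inverse)
  qed
  have "((\<lambda>h. flat q h / h) \<longlongrightarrow> 0) (at_left 0)"
    by (rule Lim_transform_eventually[OF tendsto_const])
      (rule eventually_mono[OF eventually_at_left_real[of "-1"]], auto simp: flat_def)
  with lim have "((\<lambda>h. flat q h / h) \<longlongrightarrow> 0) (at 0)" by (simp add: filterlim_split_at)
  then show ?thesis using equal by (simp add: DERIV_def flat_def)
next
  case greater
  have "((\<lambda>s. poly q (1 / s) * exp (- (1 / s))) has_real_derivative flat (flat_deriv q) s) (at s)"
    using greater
    by (auto intro!: derivative_eq_intros poly_DERIV[THEN DERIV_chain2]
      simp: flat_def flat_deriv_def poly_monom field_simps power2_eq_square)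
  then show ?thesis
    by (rule has_field_derivative_transform_within_open[of _ _ _ "{0<..}"]) (use greater in \<open>auto simp: flat_def\<close>)
qed

lemma continuous_on_flat: "continuous_on A (flat q)"
  by (meson DERIV_isCont continuous_at_imp_continuous_on flat_has_real_derivative)

text \<open>The product is continuous and vanishes off [-1,1]. The derivatives of the cutoff below
  are combinations of such products.\<close>

lemma flat_window_bounded: "\<exists>C. \<forall>s. \<bar>flat p (1 + s) * flat q (1 - s)\<bar> \<le> C"
proof -
  have "bounded ((\<lambda>s. flat p (1 + s) * flat q (1 - s)) ` {-1..1})"
    by (intro compact_imp_bounded compact_continuous_image continuous_on_mult
        continuous_on_compose2[OF continuous_on_flat[of UNIV]]) (auto intro!: continuous_intros)
  then obtain C where C: "\<And>s. s \<in> {-1..1} \<Longrightarrow> \<bar>flat p (1 + s) * flat q (1 - s)\<bar> \<le> C"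
    unfolding bounded_iff real_norm_def by blast
  have "\<bar>flat p (1 + s) * flat q (1 - s)\<bar> \<le> C" for s
  proof (cases "s \<in> {-1..1}")
    case False
    then have "flat p (1 + s) * flat q (1 - s) = 0" by (auto simp: flat_def)
    moreover have "0 \<le> C" using order_trans[OF abs_ge_zero C[of 0]] by simp
    ultimately show ?thesis by (simp only: abs_zero)
  qed (use C in blast)
  then show ?thesis by blast
qed

text \<open>An algebra of functions that is closed under directional derivatives, so that smoothness of
  its members need not be checked order by order.\<close>

inductive_set smooth_alg :: "('a::real_normed_vector \<Rightarrow> complex) set" where
  const: "(\<lambda>_. c) \<in> smooth_alg"
| linear: "bounded_linear l \<Longrightarrow> l \<in> smooth_alg"
| flat: "bounded_linear l \<Longrightarrow> (\<lambda>p. of_real (flat q (l p + r))) \<in> smooth_alg"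
| add: "f \<in> smooth_alg \<Longrightarrow> g \<in> smooth_alg \<Longrightarrow> (\<lambda>p. f p + g p) \<in> smooth_alg"
| mult: "f \<in> smooth_alg \<Longrightarrow> g \<in> smooth_alg \<Longrightarrow> (\<lambda>p. f p * g p) \<in> smooth_alg"
| exp: "f \<in> smooth_alg \<Longrightarrow> (\<lambda>p. exp (f p)) \<in> smooth_alg"

lemma dir_deriv_eqI: "(f has_derivative f') (at p) \<Longrightarrow> dir_deriv v f p = f' v"
  unfolding dir_deriv_def using frechet_derivative_at by metis

text \<open>The derivative and its membership in the algebra go through the induction with one
  common \<open>D\<close>, because the product and exponential rules multiply derivatives by the
  functions themselves. The \<open>flat\<close> case closes since \<open>flat_deriv\<close> changes
  only the polynomial.\<close>

lemma smooth_alg_has_derivative: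
  assumes "f \<in> smooth_alg"
  shows "\<exists>D. (\<forall>p. (f has_derivative D p) (at p)) \<and> (\<forall>v. (\<lambda>p. D p v) \<in> smooth_alg)"
  using assms
proof induction
  case (const c)
  show ?case by (rule exI[of _ "\<lambda>_ _. 0"]) (auto intro: smooth_alg.const)
next
  case (linear l)
  show ?case
    by (rule exI[of _ "\<lambda>_. l"])
      (auto intro: smooth_alg.const bounded_linear_imp_has_derivative linear)
next
  case (flat l q r)
  have "((\<lambda>p. flat q (l p + r)) has_derivative (\<lambda>v. flat (flat_deriv q) (l p + r) * l v)) (at p)" for p
    using flat_has_real_derivative[of q "l p + r", unfolded has_field_derivative_def]
    by (rule has_derivative_compose[rotated])
      (auto intro!: derivative_eq_intros bounded_linear_imp_has_derivative[OF flat])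
  then have "((\<lambda>p. complex_of_real (flat q (l p + r))) has_derivative
      (\<lambda>v. of_real (flat (flat_deriv q) (l p + r)) * of_real (l v))) (at p)" for p
    using has_derivative_of_real by fastforce
  then show ?case
    by (intro exI[of _ "\<lambda>p v. of_real (flat (flat_deriv q) (l p + r)) * of_real (l v)"])
      (simp add: smooth_alg.mult smooth_alg.const smooth_alg.flat[OF flat])
next
  case (add f g)
  then obtain D E where "\<forall>p. (f has_derivative D p) (at p)" "\<forall>v. (\<lambda>p. D p v) \<in> smooth_alg"
      "\<forall>p. (g has_derivative E p) (at p)" "\<forall>v. (\<lambda>p. E p v) \<in> smooth_alg" by blast
  then show ?case
    by (intro exI[of _ "\<lambda>p v. D p v + E p v"]) (auto intro!: smooth_alg.add smooth_alg.mult smooth_alg.const smooth_alg.exp has_derivative_add)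
next
  case (mult f g)
  then obtain D E where "\<forall>p. (f has_derivative D p) (at p)" "\<forall>v. (\<lambda>p. D p v) \<in> smooth_alg"
      "\<forall>p. (g has_derivative E p) (at p)" "\<forall>v. (\<lambda>p. E p v) \<in> smooth_alg" by blast
  with mult.hyps show ?case
    by (intro exI[of _ "\<lambda>p v. f p * E p v + D p v * g p"])
      (auto intro!: smooth_alg.add smooth_alg.mult smooth_alg.const smooth_alg.exp has_derivative_mult)
next
  case (exp f)
  then obtain D where D: "\<forall>p. (f has_derivative D p) (at p)" "\<forall>v. (\<lambda>p. D p v) \<in> smooth_alg" by blast
  have "((\<lambda>p. exp (f p)) has_derivative (\<lambda>v. exp (f p) * D p v)) (at p)" for p
    using D(1) DERIV_exp[of "f p", unfolded has_field_derivative_def]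
    by (auto intro!: has_derivative_compose[of f "D p" p UNIV exp])
  with D exp.hyps show ?case
    by (intro exI[of _ "\<lambda>p v. exp (f p) * D p v"]) (auto intro!: smooth_alg.add smooth_alg.mult smooth_alg.const smooth_alg.exp)
qed

lemma smooth_alg_differentiable: "f \<in> smooth_alg \<Longrightarrow> f differentiable (at p)"
  using smooth_alg_has_derivative differentiable_def by blast

lemma smooth_alg_dir_deriv: "f \<in> smooth_alg \<Longrightarrow> dir_deriv v f \<in> smooth_alg"
proof -
  assume "f \<in> smooth_alg"
  then obtain D where D: "\<forall>p. (f has_derivative D p) (at p)" "\<forall>v. (\<lambda>p. D p v) \<in> smooth_alg"
    using smooth_alg_has_derivative by blast
  then have "dir_deriv v f = (\<lambda>p. D p v)" using dir_deriv_eqI by blast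
  with D show ?thesis by simp
qed

lemma smooth_alg_smooth: "f \<in> smooth_alg \<Longrightarrow> smooth f"
proof -
  have "f \<in> smooth_alg \<Longrightarrow> C_k k f" for k and f :: "'a \<Rightarrow> complex"
  proof (induction k arbitrary: f)
    case 0
    then show ?case
      by (auto simp: continuous_on_eq_continuous_within
          intro: differentiable_imp_continuous_within smooth_alg_differentiable)
  next
    case (Suc k)
    then show ?case by (auto intro: smooth_alg_differentiable smooth_alg_dir_deriv)
  qed
  then show "f \<in> smooth_alg \<Longrightarrow> smooth f" by (simp add: smooth_def)
qed

lemma smooth_alg_poly: "f \<in> smooth_alg \<Longrightarrow> (\<lambda>p. poly q (f p)) \<in> smooth_alg"
  by (induction q) (auto intro: smooth_alg.intros)

subsection \<open>Truncated solutions of the adjoint equation\<close>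

text \<open>The cutoff is not 1 near 0; what counts is that it lies between \<open>exp (- 4)\<close>
  and 1 on [-1/2,1/2] and vanishes off [-1,1].\<close>

definition bump :: "real \<Rightarrow> real" where
  "bump s = flat 1 (1 + s) * flat 1 (1 - s)"

definition bump' :: "real \<Rightarrow> real" where
  "bump' s = flat (flat_deriv 1) (1 + s) * flat 1 (1 - s) - flat 1 (1 + s) * flat (flat_deriv 1) (1 - s)"

definition bump'' :: "real \<Rightarrow> real" where
  "bump'' s = flat (flat_deriv (flat_deriv 1)) (1 + s) * flat 1 (1 - s)
     - 2 * (flat (flat_deriv 1) (1 + s) * flat (flat_deriv 1) (1 - s))
     + flat 1 (1 + s) * flat (flat_deriv (flat_deriv 1)) (1 - s)"

lemma flat_window_has_real_derivative:
  "((\<lambda>s. flat p (1 + s) * flat q (1 - s)) has_real_derivative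
     flat (flat_deriv p) (1 + s) * flat q (1 - s) - flat p (1 + s) * flat (flat_deriv q) (1 - s)) (at s)"
proof -
  have "((\<lambda>s. 1 + s) has_real_derivative 1) (at s)" "((\<lambda>s. 1 - s) has_real_derivative - 1) (at s)"
    by (auto intro!: derivative_eq_intros)
  from DERIV_mult[OF this[THEN DERIV_chain2[OF flat_has_real_derivative]], of p q]
  show ?thesis by (simp add: mult.commute)
qed

lemma bump_has_real_derivative: "(bump has_real_derivative bump' s) (at s)"
  unfolding bump_def[abs_def] bump'_def by (rule flat_window_has_real_derivative)

lemma bump'_has_real_derivative: "(bump' has_real_derivative bump'' s) (at s)"
proof -
  have "(bump' has_real_derivative
      (flat (flat_deriv (flat_deriv 1)) (1 + s) * flat 1 (1 - s) - flat (flat_deriv 1) (1 + s) * flat (flat_deriv 1) (1 - s))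
      - (flat (flat_deriv 1) (1 + s) * flat (flat_deriv 1) (1 - s) - flat 1 (1 + s) * flat (flat_deriv (flat_deriv 1)) (1 - s))) (at s)"
    unfolding bump'_def[abs_def] by (intro DERIV_diff flat_window_has_real_derivative)
  then show ?thesis by (rule DERIV_cong) (simp add: bump''_def)
qed

lemma bump_derivs_bounded: obtains C where "\<And>s. \<bar>bump' s\<bar> \<le> C" "\<And>s. \<bar>bump'' s\<bar> \<le> C"
proof -
  define w where "w = (\<lambda>p q s. flat p (1 + s) * flat q (1 - s))"
  define C where "C = (\<lambda>p q. SOME C. \<forall>s. \<bar>w p q s\<bar> \<le> C)"
  have C: "\<bar>w p q s\<bar> \<le> C p q" for p q s
    using someI_ex[OF flat_window_bounded[of p q]] by (simp add: C_def w_def)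
  let ?d = "flat_deriv 1" and ?d2 = "flat_deriv (flat_deriv 1)"
  have "bump' s = w ?d 1 s - w 1 ?d s" "bump'' s = w ?d2 1 s - 2 * w ?d ?d s + w 1 ?d2 s" for s
    by (simp_all add: bump'_def bump''_def w_def)
  then have "\<bar>bump' s\<bar> \<le> C ?d 1 + C 1 ?d" "\<bar>bump'' s\<bar> \<le> C ?d2 1 + 2 * C ?d ?d + C 1 ?d2" for s
    using C[of ?d 1 s] C[of 1 ?d s] C[of ?d2 1 s] C[of ?d ?d s] C[of 1 ?d2 s] by simp_all
  then show ?thesis
    by (intro that[of "max (C ?d 1 + C 1 ?d) (C ?d2 1 + 2 * C ?d ?d + C 1 ?d2)"])
      (meson max.coboundedI1 max.coboundedI2)+
qed

lemma flat_one_bounds: "0 \<le> flat 1 s" "flat 1 s \<le> 1"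
  by (auto simp: flat_def)

lemma bump_bounds: "0 \<le> bump s" "bump s \<le> 1"
  using flat_one_bounds[of "1 + s"] flat_one_bounds[of "1 - s"]
  by (auto simp: bump_def intro: mult_le_one)

lemma bump_eq_0: "\<bar>s\<bar> \<ge> 1 \<Longrightarrow> bump s = 0"
  by (auto simp: bump_def flat_def)

lemma bump_ge: "\<bar>s\<bar> \<le> 1 / 2 \<Longrightarrow> bump s \<ge> exp (- 4)"
proof -
  assume s: "\<bar>s\<bar> \<le> 1 / 2"
  have "flat 1 r \<ge> exp (- 2)" if "r \<ge> 1 / 2" for r
    using that by (simp add: flat_def field_simps)
  from this[of "1 + s"] this[of "1 - s"] s have "exp (- 2) * exp (- 2) \<le> bump s"
    unfolding bump_def by (intro mult_mono) (auto simp: flat_one_bounds)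
  then show ?thesis by (simp flip: exp_add)
qed

text \<open>The shift by \<open>T\<close> keeps the exponential of the phase in the unit disc up to
  the final time. Taking \<open>c\<close> as the midpoint of the removed segment puts the directions
  of that segment around the positive real axis.\<close>

definition phase :: "real \<Rightarrow> real \<Rightarrow> real \<times> real \<times> real \<Rightarrow> complex" where
  "phase T c = (\<lambda>(t, x, y). of_real (t - T - x\<^sup>2 / 2) + \<i> * of_real (y - c))"

text \<open>The function \<open>exp (phase T c)\<close> and its powers \<open>exp (n * phase T c)\<close> solve the adjoint
  equation; they are the Gaussian ground states of \<open>- \<partial>\<^sub>x\<^sup>2 + n\<^sup>2 x\<^sup>2\<close>, run backwards from
  time \<open>T\<close>. The factor \<open>bump (x / R)\<close> truncates them to test functions.\<close>

definition wave :: "complex poly \<Rightarrow> real \<Rightarrow> real \<Rightarrow> real \<Rightarrow> real \<times> real \<times> real \<Rightarrow> complex" where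
  "wave p T c R = (\<lambda>(t, x, y). of_real (bump (x / R)) * poly p (exp (phase T c (t, x, y))))"

section \<open>Size and admissibility of the truncated waves\<close>

lemma norm_exp_phase: "norm (exp (phase T c (t, x, y))) = exp (t - T - x\<^sup>2 / 2)"
  by (simp add: phase_def norm_exp_eq_Re)

lemma norm_exp_phase_le:
  assumes "t \<le> T"
  shows "norm (exp (phase T c (t, x, y))) \<le> exp (- x\<^sup>2 / 2)"
  unfolding norm_exp_phase using assms by simp

lemma norm_exp_phase_le_1:
  assumes "t \<le> T"
  shows "norm (exp (phase T c (t, x, y))) \<le> 1"
proof (rule order_trans[OF norm_exp_phase_le[OF assms]])
  have "- x\<^sup>2 / 2 \<le> 0" using zero_le_power2[of x] by linarith
  then show "exp (- x\<^sup>2 / 2) \<le> 1" by (simp only: exp_le_one_iff)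
qed

lemma exp_phase_in_smooth_alg: "(\<lambda>q. exp (phase T c q)) \<in> smooth_alg"
proof -
  have l: "bounded_linear (\<lambda>q::real\<times>real\<times>real. complex_of_real (fst q))"
    "bounded_linear (\<lambda>q::real\<times>real\<times>real. complex_of_real (fst (snd q)))"
    "bounded_linear (\<lambda>q::real\<times>real\<times>real. complex_of_real (snd (snd q)))"
    by (intro bounded_linear_compose[OF bounded_linear_of_real]
        bounded_linear_compose[OF bounded_linear_fst] bounded_linear_compose[OF bounded_linear_snd]
        bounded_linear_fst bounded_linear_snd)+
  have "phase T c = (\<lambda>q. (of_real (fst q) + (of_real (fst (snd q)) * of_real (fst (snd q))) * (- 1 / 2))
      + (\<i> * of_real (snd (snd q)) + (- of_real T - \<i> * of_real c)))"
    by (auto simp: phase_def fun_eq_iff power2_eq_square algebra_simps)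
  also have "\<dots> \<in> smooth_alg"
    by (intro smooth_alg.add smooth_alg.mult smooth_alg.linear smooth_alg.const l)
  finally show ?thesis by (rule smooth_alg.exp)
qed

lemma wave_in_smooth_alg: "wave p T c R \<in> smooth_alg"
proof -
  have l: "bounded_linear (\<lambda>q::real\<times>real\<times>real. fst (snd q) * a)" for a
    by (intro bounded_linear_mult_const bounded_linear_compose[OF bounded_linear_fst bounded_linear_snd])
  have "wave p T c R = (\<lambda>q. (of_real (flat 1 (fst (snd q) * (1 / R) + 1))
      * of_real (flat 1 (fst (snd q) * (- 1 / R) + 1))) * poly p (exp (phase T c q)))"
    by (auto simp: wave_def fun_eq_iff bump_def add.commute)
  also have "\<dots> \<in> smooth_alg"
    by (intro smooth_alg.mult smooth_alg.flat l smooth_alg_poly exp_phase_in_smooth_alg)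
  finally show ?thesis .
qed

lemma test_function_wave:
  assumes "R > 0"
  shows "test_function (wave p T c R)"
  unfolding test_function_def
proof (intro conjI allI)
  show "smooth (wave p T c R)" by (rule smooth_alg_smooth[OF wave_in_smooth_alg])
  fix t x y :: real
  have "phase T c (t, x, y + 2 * pi) = phase T c (t, x, y) + 2 * of_real pi * \<i>"
    by (simp add: phase_def algebra_simps)
  then have "exp (phase T c (t, x, y + 2 * pi)) = exp (phase T c (t, x, y))"
    by (simp add: exp_add)
  then show "wave p T c R (t, x, y + 2 * pi) = wave p T c R (t, x, y)"
    by (simp add: wave_def)
next
  have "wave p T c R (t, x, y) = 0" if "\<bar>x\<bar> > R" for t x y
    using that assms by (simp add: wave_def bump_eq_0)
  then show "\<exists>R'. \<forall>t x y. \<bar>x\<bar> > R' \<longrightarrow> wave p T c R (t, x, y) = 0" by blast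
qed

text \<open>Differentiability turns each partial derivative into an ordinary derivative along a
  coordinate line, so the operator can be computed by one-variable rules.\<close>

lemma partial_derivs:
  fixes f :: "real \<times> real \<times> real \<Rightarrow> complex"
  assumes "f differentiable (at (t, x, y))"
  shows "((\<lambda>s. f (s, x, y)) has_vector_derivative D) (at t) \<Longrightarrow> d_t f (t, x, y) = D"
    and "((\<lambda>s. f (t, s, y)) has_vector_derivative D) (at x) \<Longrightarrow> d_x f (t, x, y) = D"
    and "((\<lambda>s. f (t, x, s)) has_vector_derivative D) (at y) \<Longrightarrow> d_y f (t, x, y) = D"
proof -
  obtain f' where f': "(f has_derivative f') (at (t, x, y))" using assms differentiable_def by blast
  have 1: "((\<lambda>s. f (s, x, y)) has_derivative (\<lambda>h. f' (h, 0, 0))) (at t)"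
    by (rule has_derivative_compose[of "\<lambda>s. (s, x, y)" _ _ _ f f'])
      (use f' in \<open>auto intro!: derivative_eq_intros simp: zero_prod_def\<close>)
  have 2: "((\<lambda>s. f (t, s, y)) has_derivative (\<lambda>h. f' (0, h, 0))) (at x)"
    by (rule has_derivative_compose[of "\<lambda>s. (t, s, y)" _ _ _ f f'])
      (use f' in \<open>auto intro!: derivative_eq_intros simp: zero_prod_def\<close>)
  have 3: "((\<lambda>s. f (t, x, s)) has_derivative (\<lambda>h. f' (0, 0, h))) (at y)"
    by (rule has_derivative_compose[of "\<lambda>s. (t, x, s)" _ _ _ f f'])
      (use f' in \<open>auto intro!: derivative_eq_intros simp: zero_prod_def\<close>)
  show "d_t f (t, x, y) = D" if "((\<lambda>s. f (s, x, y)) has_vector_derivative D) (at t)"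
    using fun_cong[OF has_derivative_unique[OF 1 that[unfolded has_vector_derivative_def]], of 1]
    by (simp add: dir_deriv_eqI[OF f'])
  show "d_x f (t, x, y) = D" if "((\<lambda>s. f (t, s, y)) has_vector_derivative D) (at x)"
    using fun_cong[OF has_derivative_unique[OF 2 that[unfolded has_vector_derivative_def]], of 1]
    by (simp add: dir_deriv_eqI[OF f'])
  show "d_y f (t, x, y) = D" if "((\<lambda>s. f (t, x, s)) has_vector_derivative D) (at y)"
    using fun_cong[OF has_derivative_unique[OF 3 that[unfolded has_vector_derivative_def]], of 1]
    by (simp add: dir_deriv_eqI[OF f'])
qed

text \<open>Without the cutoff the function solves the adjoint equation exactly. What survives is
  the commutator of the second x-derivative with the cutoff, where the factor \<open>x\<close> comes
  from the x-derivative of the phase.\<close>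

lemma grushin_adjoint_wave:
  "grushin_adjoint (wave p T c R) (t, x, y) =
     of_real (2 * x * bump' (x / R) / R) * (exp (phase T c (t, x, y)) * poly (pderiv p) (exp (phase T c (t, x, y))))
     - of_real (bump'' (x / R) / R\<^sup>2) * poly p (exp (phase T c (t, x, y)))"
proof -
  \<comment> \<open>Seen as functions of the phase, \<open>F'\<close> and \<open>F''\<close> are the
    successive derivatives of \<open>F\<close>; the chain rule then needs only the partial
    derivatives 1, -x and i of the phase.\<close>
  define F where "F = (\<lambda>z. poly p (exp z))"
  define F' where "F' = (\<lambda>z. exp z * poly (pderiv p) (exp z))"
  define F'' where "F'' = (\<lambda>z. exp z * poly (pderiv p) (exp z) + (exp z)\<^sup>2 * poly (pderiv (pderiv p)) (exp z))"
  have F: "(F has_field_derivative F' z) (at z)" and F': "(F' has_field_derivative F'' z) (at z)" for z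
    unfolding F_def F'_def F''_def
    by (auto intro!: derivative_eq_intros poly_DERIV[THEN DERIV_chain2] simp: power2_eq_square)
  let ?P = "phase T c" and ?w = "wave p T c R"
  have Pt: "((\<lambda>s. ?P (s, x, y)) has_vector_derivative 1) (at t)"
   and Px: "((\<lambda>s. ?P (t, s, y)) has_vector_derivative - of_real x) (at x)"
   and Py: "((\<lambda>s. ?P (t, x, s)) has_vector_derivative \<i>) (at y)" for t x y
  proof -
    have r: "((\<lambda>s. s - T - x\<^sup>2 / 2) has_real_derivative 1) (at t)"
      "((\<lambda>s. t - T - s\<^sup>2 / 2) has_real_derivative - x) (at x)"
      "((\<lambda>s. s - c) has_real_derivative 1) (at y)"
      by (auto intro!: derivative_eq_intros)
    show "((\<lambda>s. ?P (s, x, y)) has_vector_derivative 1) (at t)"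
      and "((\<lambda>s. ?P (t, s, y)) has_vector_derivative - of_real x) (at x)"
      and "((\<lambda>s. ?P (t, x, s)) has_vector_derivative \<i>) (at y)"
      unfolding phase_def prod.case
      using has_vector_derivative_add[OF has_vector_derivative_of_real[OF r(1)] has_vector_derivative_const]
        has_vector_derivative_add[OF has_vector_derivative_of_real[OF r(2)] has_vector_derivative_const]
        has_vector_derivative_add[OF has_vector_derivative_const
          has_vector_derivative_mult_right[OF has_vector_derivative_of_real[OF r(3)]], of _ \<i>]
      by (simp_all only: of_real_1 of_real_minus add_0_right add_0_left mult_1_right)
  qed
  note chain = field_vector_diff_chain_at[unfolded o_def]
  have d: "((\<lambda>s. s / R) has_real_derivative 1 / R) (at x)" for x
    by (rule DERIV_cdivide[OF DERIV_ident])
  have X: "((\<lambda>s. complex_of_real (bump (s / R))) has_vector_derivative of_real (bump' (x / R) / R)) (at x)" for x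
    using DERIV_chain2[OF bump_has_real_derivative d]
    by (intro has_vector_derivative_of_real) simp
  have X': "((\<lambda>s. complex_of_real (bump' (s / R) / R)) has_vector_derivative of_real (bump'' (x / R) / R\<^sup>2)) (at x)" for x
    using DERIV_cdivide[OF DERIV_chain2[OF bump'_has_real_derivative d], of R]
    by (intro has_vector_derivative_of_real) (simp add: power2_eq_square)
  have w: "?w (t, x, y) = of_real (bump (x / R)) * F (?P (t, x, y))" for t x y
    by (simp add: wave_def F_def)
  have diff: "?w differentiable (at q)" "dir_deriv v ?w differentiable (at q)" for q v
    by (auto intro!: smooth_alg_differentiable smooth_alg_dir_deriv wave_in_smooth_alg)
  have dt: "d_t ?w (t, x, y) = of_real (bump (x / R)) * F' (?P (t, x, y))" for t x y
    by (rule partial_derivs(1)[OF diff(1)], unfold w)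
      (use has_vector_derivative_mult_right[OF chain[OF Pt F]] in simp)
  have dx: "d_x ?w (t, x, y) = of_real (bump (x / R)) * (- of_real x * F' (?P (t, x, y)))
      + of_real (bump' (x / R) / R) * F (?P (t, x, y))" for t x y
    by (rule partial_derivs(2)[OF diff(1)], unfold w)
      (rule has_vector_derivative_mult[OF X chain[OF Px F]])
  have id: "((\<lambda>s. - complex_of_real s) has_vector_derivative - 1) (at x)" for x
    by (auto intro!: derivative_eq_intros)
  have dxx: "d_x (d_x ?w) (t, x, y) =
      (of_real (bump (x / R)) * (- of_real x * (- of_real x * F'' (?P (t, x, y))) + (- 1) * F' (?P (t, x, y)))
        + of_real (bump' (x / R) / R) * (- of_real x * F' (?P (t, x, y))))
      + (of_real (bump' (x / R) / R) * (- of_real x * F' (?P (t, x, y)))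
        + of_real (bump'' (x / R) / R\<^sup>2) * F (?P (t, x, y)))" for t x y
    by (rule partial_derivs(2)[OF diff(2)], unfold dx)
      (rule has_vector_derivative_add[OF
         has_vector_derivative_mult[OF X has_vector_derivative_mult[OF id chain[OF Px F']]]
         has_vector_derivative_mult[OF X' chain[OF Px F]]])
  have dy: "d_y ?w (t, x, y) = of_real (bump (x / R)) * (\<i> * F' (?P (t, x, y)))" for t x y
    by (rule partial_derivs(3)[OF diff(1)], unfold w)
      (rule has_vector_derivative_mult_right[OF chain[OF Py F]])
  have dyy: "d_y (d_y ?w) (t, x, y) = of_real (bump (x / R)) * (\<i> * (\<i> * F'' (?P (t, x, y))))" for t x y
    by (rule partial_derivs(3)[OF diff(2)], unfold dy)
      (intro has_vector_derivative_mult_right chain[OF Py F'])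
  \<comment> \<open>Two cancellations: the terms in \<open>F2\<close> from the second derivatives in
    x and y, and the plain \<open>F1\<close> of the time derivative against the one from
    differentiating the factor -x.\<close>
  have collect: "- (B * F1) - ((B * (- X * (- X * F2) + (- 1) * F1) + b1 * (- X * F1))
      + (b1 * (- X * F1) + b2 * F0)) - X\<^sup>2 * (B * (\<i> * (\<i> * F2))) = 2 * X * b1 * F1 - b2 * F0"
    for B F0 F1 F2 X b1 b2 :: complex
  proof -
    have *: "\<i> * (\<i> * F2) = - F2" by simp
    show ?thesis unfolding * by (simp add: algebra_simps power2_eq_square)
  qed
  have x: "complex_of_real (2 * x * bump' (x / R) / R) = 2 * of_real x * of_real (bump' (x / R) / R)" by simp
  show ?thesis
    unfolding grushin_adjoint_def prod.case dt dxx dyy of_real_power collect x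
    by (simp only: F_def F'_def)
qed

subsection \<open>Integration on the cylinder\<close>

lemma integrable_lborel_prod_mult:
  fixes f :: "'a::euclidean_space \<Rightarrow> real" and g :: "'b::euclidean_space \<Rightarrow> real"
  assumes f: "integrable lborel f" and g: "integrable lborel g"
  shows "integrable lborel (\<lambda>(x, y). f x * g y)"
proof -
  have [measurable]: "f \<in> borel_measurable borel" "g \<in> borel_measurable borel"
    using f g by (auto dest: borel_measurable_integrable)
  have "integrable (lborel \<Otimes>\<^sub>M lborel) (\<lambda>(x, y). f x * g y)"
  proof (rule lborel_pair.Fubini_integrable)
    show "(\<lambda>(x, y). f x * g y) \<in> borel_measurable (lborel \<Otimes>\<^sub>M lborel)" by measurable
    show "integrable lborel (\<lambda>x. \<integral>y. norm (case (x, y) of (x, y) \<Rightarrow> f x * g y) \<partial>lborel)"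
      using f g by (simp add: abs_mult)
    show "AE x in lborel. integrable lborel (\<lambda>y. case (x, y) of (x, y) \<Rightarrow> f x * g y)"
      using g by simp
  qed
  then show ?thesis by (simp add: lborel_prod)
qed

lemma integrable_gaussian: "integrable lborel (\<lambda>x::real. exp (- x\<^sup>2 / 2))"
proof -
  have "integrable lborel (\<lambda>x. sqrt (2 * pi) * normal_density 0 1 x)"
    by (intro integrable_mult_right integrable_normal_density) simp
  then show ?thesis by (simp add: normal_density_def)
qed

lemma integrable_indicator_lborel:
  fixes A :: "real set"
  assumes "A \<in> sets borel" "A \<subseteq> {a..b}"
  shows "integrable lborel (indicator A :: real \<Rightarrow> real)"
proof (subst integrable_indicator_iff)
  have "emeasure lborel A \<le> emeasure lborel {a..b}" using assms by (intro emeasure_mono) auto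
  also have "\<dots> < \<infinity>" by (cases "a \<le> b") auto
  finally show "A \<inter> space lborel \<in> sets lborel \<and> emeasure lborel (A \<inter> space lborel) < \<infinity>"
    using assms by simp
qed

lemma cyl_dom_measurable: "cyl_dom \<in> sets borel"
  unfolding cyl_dom_def by (intro borel_Times) auto

lemma integrable_gaussian_strip:
  assumes "V \<in> sets borel" "V \<subseteq> {a..b}"
  shows "integrable lborel (\<lambda>(x, y). exp (- x\<^sup>2 / 2) * indicator V (y::real) :: real)"
  by (rule integrable_lborel_prod_mult[OF integrable_gaussian integrable_indicator_lborel[OF assms]])

lemma integrable_cyl_gaussian: "integrable cyl (\<lambda>(x, y). exp (- x\<^sup>2 / 2) :: real)"
proof -
  have "integrable lborel (\<lambda>(x, y). exp (- x\<^sup>2 / 2) * indicator {0..<2 * pi} y :: real)"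
    by (rule integrable_gaussian_strip[where a = 0 and b = "2 * pi"]) auto
  also have "(\<lambda>(x, y). exp (- x\<^sup>2 / 2) * indicator {0..<2 * pi} y :: real)
      = (\<lambda>p. indicator cyl_dom p *\<^sub>R (case p of (x, y) \<Rightarrow> exp (- x\<^sup>2 / 2)))"
    by (auto simp: fun_eq_iff cyl_dom_def split: split_indicator)
  finally show ?thesis
    unfolding cyl_def using cyl_dom_measurable by (simp add: integrable_restrict_space)
qed

lemma integrable_control_space_gaussian:
  assumes V: "V \<in> sets borel"
  shows "integrable (control_space T (UNIV \<times> V)) (\<lambda>(t, x, y). exp (- x\<^sup>2 / 2) :: real)"
proof -
  let ?W = "V \<inter> {0..<2 * pi}"
  have W: "?W \<in> sets borel" using V by auto
  have "integrable lborel (\<lambda>(t::real, p). indicator {0..T} t * (case p of (x, y) \<Rightarrow> exp (- x\<^sup>2 / 2) * indicator ?W y) :: real)"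
    by (rule integrable_lborel_prod_mult[OF integrable_indicator_lborel
          integrable_gaussian_strip[OF W, where a = 0 and b = "2 * pi"]]) auto
  also have "(\<lambda>(t::real, p). indicator {0..T} t * (case p of (x, y) \<Rightarrow> exp (- x\<^sup>2 / 2) * indicator ?W y) :: real)
      = (\<lambda>q. indicator ({0..T} \<times> ((UNIV \<times> V) \<inter> cyl_dom)) q *\<^sub>R (case q of (t, x, y) \<Rightarrow> exp (- x\<^sup>2 / 2)))"
    by (auto simp: fun_eq_iff cyl_dom_def split: split_indicator)
  finally have *: "integrable lborel
      (\<lambda>q. indicator ({0..T} \<times> ((UNIV \<times> V) \<inter> cyl_dom)) q *\<^sub>R ((case q of (t, x, y) \<Rightarrow> exp (- x\<^sup>2 / 2)) :: real))" .
  have "(UNIV \<times> V) \<inter> cyl_dom = UNIV \<times> ?W" by (auto simp: cyl_dom_def)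
  then have "{0..T} \<times> ((UNIV \<times> V) \<inter> cyl_dom) \<in> sets borel"
    using W by (auto intro!: borel_Times)
  with * show ?thesis unfolding control_space_def by (subst integrable_restrict_space) auto
qed

lemma torus_segment_measurable: "torus_segment a b \<in> sets borel"
proof -
  have *: "torus_segment a b = (\<Union>k::int. {a - 2 * pi * of_int k .. b - 2 * pi * of_int k})"
    by (auto simp: torus_segment_def algebra_simps)
  show ?thesis unfolding * by (intro sets.countable_UN') auto
qed

text \<open>Compactness of [0,T]: times with unbounded norms would accumulate at some
  \<open>t\<close>, near which continuity bounds the squared norm by
  \<open>2 + 2 * g t\<close>.\<close>

lemma continuous_L2_bounded:
  assumes "continuous_L2 T M f"
  obtains N where "\<And>t. t \<in> {0..T} \<Longrightarrow> (LINT p|M. (norm (f t p))\<^sup>2) \<le> N"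
proof -
  define g where "g = (\<lambda>t. LINT p|M. (norm (f t p))\<^sup>2)"
  have L2: "f t \<in> borel_measurable M" "integrable M (\<lambda>p. (norm (f t p))\<^sup>2)" if "t \<in> {0..T}" for t
    using assms that by (auto simp: continuous_L2_def L2_def)
  have near: "g s \<le> 2 * (LINT p|M. (norm (f s p - f t p))\<^sup>2) + 2 * g t"
    if t: "t \<in> {0..T}" and s: "s \<in> {0..T}" for s t
  proof -
    have ineq: "(norm u)\<^sup>2 \<le> 2 * (norm (u - v))\<^sup>2 + 2 * (norm v)\<^sup>2" for u v :: complex
    proof -
      have "(norm u)\<^sup>2 \<le> (norm (u - v) + norm v)\<^sup>2"
        using norm_triangle_ineq[of "u - v" v] by (intro power_mono) auto
      also have "\<dots> \<le> 2 * (norm (u - v))\<^sup>2 + 2 * (norm v)\<^sup>2"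
        using zero_le_power2[of "norm (u - v) - norm v"] by (simp add: power2_eq_square algebra_simps)
      finally show ?thesis .
    qed
    have ineq': "(norm (u - v))\<^sup>2 \<le> 2 * (norm u)\<^sup>2 + 2 * (norm v)\<^sup>2" for u v :: complex
      using ineq[of "u - v" "- v"] by simp
    have d: "integrable M (\<lambda>p. (norm (f s p - f t p))\<^sup>2)"
    proof (rule Bochner_Integration.integrable_bound)
      show "integrable M (\<lambda>p. 2 * (norm (f s p))\<^sup>2 + 2 * (norm (f t p))\<^sup>2)"
        using L2[OF t] L2[OF s] by simp
      show "(\<lambda>p. (norm (f s p - f t p))\<^sup>2) \<in> borel_measurable M"
        using L2[OF t] L2[OF s] by simp
    qed (use ineq' in \<open>auto intro!: AE_I2\<close>)
    have "g s \<le> (LINT p|M. 2 * (norm (f s p - f t p))\<^sup>2 + 2 * (norm (f t p))\<^sup>2)"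
      unfolding g_def using L2[OF t] L2[OF s] d ineq by (intro integral_mono) auto
    also have "\<dots> = 2 * (LINT p|M. (norm (f s p - f t p))\<^sup>2) + 2 * g t"
      unfolding g_def using L2[OF t] d by simp
    finally show ?thesis .
  qed
  have "\<exists>N. \<forall>t\<in>{0..T}. g t \<le> N"
  proof (rule ccontr)
    assume "\<nexists>N. \<forall>t\<in>{0..T}. g t \<le> N"
    then have "\<forall>n::nat. \<exists>t\<in>{0..T}. g t > real n" by (meson not_le)
    then obtain s where s: "\<And>n. s n \<in> {0..T}" "\<And>n. g (s n) > real n" by metis
    obtain t r where t: "t \<in> {0..T}" and r: "strict_mono r" and lim: "(s \<circ> r) \<longlonglongrightarrow> t"
      using compact_Icc[of 0 T] s(1) unfolding compact_eq_seq_compact_metric seq_compact_def by metis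
    have "((\<lambda>s. LINT p|M. (norm (f s p - f t p))\<^sup>2) \<longlongrightarrow> 0) (at t within {0..T})"
      using assms t by (auto simp: continuous_L2_def)
    then obtain d where d: "d > 0" "\<And>s. s \<in> {0..T} \<Longrightarrow> s \<noteq> t \<Longrightarrow> dist s t < d \<Longrightarrow> (LINT p|M. (norm (f s p - f t p))\<^sup>2) < 1"
      by (auto simp: order_tendsto_iff eventually_at dest!: spec[of _ "1::real"])
    have "\<forall>\<^sub>F n in sequentially. dist ((s \<circ> r) n) t < d" using lim d(1) by (simp add: tendsto_iff)
    moreover have "\<forall>\<^sub>F n in sequentially. n \<ge> nat \<lceil>2 + 2 * g t\<rceil>" by (rule eventually_ge_at_top)
    ultimately have "\<forall>\<^sub>F n in sequentially. False"
    proof eventually_elim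
      case (elim n)
      \<comment> \<open>The choice of \<open>d\<close> speaks only of times other than
        \<open>t\<close>; at \<open>t\<close> itself the integral is 0.\<close>
      have "(LINT p|M. (norm (f (s (r n)) p - f t p))\<^sup>2) \<le> 1"
        using elim(1) d(2)[OF s(1), of "r n"] by (cases "s (r n) = t") auto
      then have "g (s (r n)) \<le> 2 + 2 * g t" using near[OF t s(1), of "r n"] by simp
      also have "\<dots> \<le> real n" using elim(2) by linarith
      also have "\<dots> \<le> real (r n)" using seq_suble[OF r] by simp
      finally show False using s(2)[of "r n"] by simp
    qed
    then show False by simp
  qed
  then show ?thesis using that unfolding g_def by blast
qed

subsection \<open>The initial datum\<close>

lemma exp_phase_eq: "exp (phase T c (t, x, y)) = of_real (exp (t - T - x\<^sup>2 / 2)) * cis (y - c)"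
  by (simp add: phase_def exp_add exp_of_real cis_conv_exp del: of_real_diff)

text \<open>\<open>t\<close> and \<open>x\<close> affect only the modulus of the exponential, and a
  \<open>y\<close> off the segment keeps its argument away from 0 modulo 2 pi by half the length of
  the segment. The cosine of that angle, once capped, is \<open>\<kappa>\<close>.\<close>

lemma exp_phase_outside_sector:
  assumes "a < b"
  obtains \<kappa> where "0 \<le> \<kappa>" "\<kappa> < 1"
    and "\<And>T t x y. y \<notin> torus_segment a b \<Longrightarrow>
      Re (exp (phase T ((a + b) / 2) (t, x, y))) \<le> \<kappa> * norm (exp (phase T ((a + b) / 2) (t, x, y)))"
proof
  \<comment> \<open>The cap at 1, which is below pi / 2, makes \<open>cos \<delta>\<close>
    nonnegative for long segments too.\<close>
  define \<delta> where "\<delta> = min ((b - a) / 2) 1"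
  let ?c = "(a + b) / 2"
  have \<delta>: "0 < \<delta>" "\<delta> \<le> 1" "\<delta> \<le> (b - a) / 2" using assms by (auto simp: \<delta>_def min_def)
  have pi: "1 < pi / 2" using pi_gt3 by simp
  show "0 \<le> cos \<delta>" using \<delta> pi by (intro cos_ge_zero) auto
  show "cos \<delta> < 1" using cos_monotone_0_pi[of 0 \<delta>] \<delta> pi by simp
  fix T t x y :: real
  assume y: "y \<notin> torus_segment a b"
  \<comment> \<open>Reduces \<open>y - ?c\<close> to a representative in [-pi, pi], where the cosine
    decreases in the absolute value.\<close>
  define k where "k = \<lfloor>(y - ?c + pi) / (2 * pi)\<rfloor>"
  define \<theta> where "\<theta> = y - ?c - 2 * pi * of_int k"
  have "of_int k \<le> (y - ?c + pi) / (2 * pi)" "(y - ?c + pi) / (2 * pi) < of_int k + 1"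
    unfolding k_def by linarith+
  then have \<theta>: "- pi \<le> \<theta>" "\<theta> \<le> pi" by (simp_all add: \<theta>_def field_simps)
  have "\<bar>\<theta>\<bar> > \<delta>"
  proof (rule ccontr)
    assume "\<not> \<bar>\<theta>\<bar> > \<delta>"
    then have "a \<le> \<theta> + ?c" "\<theta> + ?c \<le> b" using \<delta>(3) by (simp_all add: abs_le_iff field_simps)
    then have "a \<le> y - 2 * pi * of_int k" "y - 2 * pi * of_int k \<le> b" by (simp_all add: \<theta>_def)
    then have "y + 2 * pi * of_int (- k) \<in> {a..b}" by simp
    with y show False unfolding torus_segment_def by blast
  qed
  then have "cos \<bar>\<theta>\<bar> \<le> cos \<delta>" using \<theta> \<delta> by (intro cos_monotone_0_pi_le) auto
  moreover have "cos \<bar>\<theta>\<bar> = cos (y - ?c)"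
  proof -
    have "cos (\<theta> + 2 * pi * of_int k) = cos \<theta>"
      using cos_int_2pin[of k] sin_int_2pin[of k] by (simp add: cos_add)
    then show ?thesis by (simp add: \<theta>_def)
  qed
  ultimately show "Re (exp (phase T ?c (t, x, y))) \<le> cos \<delta> * norm (exp (phase T ?c (t, x, y)))"
    unfolding exp_phase_eq norm_mult norm_of_real norm_cis by (simp add: mult.commute mult_left_mono)
qed

text \<open>Cauchy's formula turns integration against the kernel \<open>w / (w - \<rho>)\<close> over the circle
  traced by \<open>w = exp (phase T c (0, x, y))\<close> into evaluation at \<open>\<rho>\<close>.\<close>

lemma integral_cauchy_kernel_phase:
  fixes T c x \<rho> :: real
  assumes "\<bar>\<rho>\<bar> < exp (- T - x\<^sup>2 / 2)"
  defines "w \<equiv> \<lambda>y. exp (phase T c (0, x, y))"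
  shows "(LINT y|lborel. indicator {0..<2 * pi} y *\<^sub>R (w y / (w y - of_real \<rho>) * poly p (w y)))
    = 2 * of_real pi * poly p (of_real \<rho>)"
proof -
  define r where "r = exp (- T - x\<^sup>2 / 2)"
  \<comment> \<open>In the variable z = r * cis y one has w = z * cis (- c), so the pole
    \<open>\<rho>\<close> in w is the pole \<open>u\<close> in z.\<close>
  define u where "u = of_real \<rho> * cis c"
  let ?g = "\<lambda>y. w y / (w y - of_real \<rho>) * poly p (w y)"
  have r: "r > 0" "\<bar>\<rho>\<bar> < r" using assms by (auto simp: r_def)
  have w: "w y = of_real r * cis (y - c)" for y by (simp add: w_def exp_phase_eq r_def)
  have wne: "w y - of_real \<rho> \<noteq> 0" for y
  proof
    assume "w y - of_real \<rho> = 0"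
    then have "norm (w y) = norm (complex_of_real \<rho>)" by simp
    then show False using r by (simp add: w norm_mult)
  qed
  have "((\<lambda>z. poly p (z * cis (- c)) / (z - u)) has_contour_integral
      (2 * of_real pi * \<i> * poly p (u * cis (- c)))) (circlepath 0 r)"
    by (rule Cauchy_integral_circlepath_simple[of "\<lambda>z. poly p (z * cis (- c))"])
      (use r in \<open>auto intro!: holomorphic_intros simp: u_def norm_mult\<close>)
  moreover have "u * cis (- c) = of_real \<rho>" by (simp add: u_def cis_mult mult.assoc)
  ultimately have "((\<lambda>t. poly p (r * cis t * cis (- c)) / (r * cis t - u) * r * \<i> * cis t)
      has_integral (2 * of_real pi * \<i> * poly p (of_real \<rho>))) {0..2 * pi}"
    unfolding circlepath_def by (subst (asm) has_contour_integral_part_circlepath_iff) auto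
  \<comment> \<open>Since dz = i z dy, the Cauchy kernel in z becomes i times w / (w -
    \<open>\<rho>\<close>); the rotation by \<open>cis c\<close> cancels in the quotient.\<close>
  moreover have "poly p (r * cis t * cis (- c)) / (r * cis t - u) * r * \<i> * cis t = \<i> * ?g t" for t
  proof -
    have "cis c * cis (t - c) = cis t" by (simp add: cis_mult)
    then have e1: "r * cis t = cis c * w t" unfolding w by (metis mult.left_commute)
    then have e2: "r * cis t - u = cis c * (w t - of_real \<rho>)"
      by (simp add: right_diff_distrib u_def mult.commute)
    have e3: "r * cis t * cis (- c) = w t" by (simp add: w cis_mult mult.assoc)
    have "poly p (r * cis t * cis (- c)) / (r * cis t - u) * r * \<i> * cis t
        = (\<i> * poly p (r * cis t * cis (- c))) * (r * cis t) / (r * cis t - u)"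
      by (simp add: mult_ac)
    also have "\<dots> = (cis c * (\<i> * poly p (w t) * w t)) / (cis c * (w t - of_real \<rho>))"
      unfolding e3 unfolding e2 unfolding e1 by (simp only: mult_ac)
    also have "\<dots> = (\<i> * poly p (w t) * w t) / (w t - of_real \<rho>)"
      by (rule mult_divide_mult_cancel_left) simp
    finally show ?thesis by (simp add: mult_ac)
  qed
  ultimately have "((\<lambda>t. \<i> * ?g t) has_integral (\<i> * (2 * of_real pi * poly p (of_real \<rho>)))) {0..2 * pi}"
    by (simp add: mult_ac)
  from has_integral_mult_right[OF this, of "- \<i>"]
  have I: "(?g has_integral (2 * of_real pi * poly p (of_real \<rho>))) {0..2 * pi}"
    by (simp flip: mult.assoc)
  have "continuous_on {0..2 * pi} ?g"
    using wne unfolding w by (intro continuous_intros) auto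
  then have S: "set_integrable lborel {0..2 * pi} ?g" by (rule borel_integrable_atLeastAtMost')
  have [measurable]: "w \<in> borel_measurable borel"
    unfolding w by (intro borel_measurable_continuous_onI continuous_intros)
  have "(LINT y|lborel. indicator {0..<2 * pi} y *\<^sub>R ?g y) = (LINT y|lborel. indicator {0..2 * pi} y *\<^sub>R ?g y)"
  proof (rule integral_cong_AE)
    show "AE y in lborel. indicator {0..<2 * pi} y *\<^sub>R ?g y = indicator {0..2 * pi} y *\<^sub>R ?g y"
      using AE_lborel_singleton[of "2 * pi"] by eventually_elim (auto split: split_indicator)
  qed (unfold poly_altdef, measurable)
  also have "\<dots> = 2 * of_real pi * poly p (of_real \<rho>)"
    using set_borel_integral_eq_integral(2)[OF S] integral_unique[OF I]
    by (simp add: set_lebesgue_integral_def)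
  finally show ?thesis .
qed

text \<open>The cutoff in \<open>x\<close> confines the exponential to moduli of at least
  \<open>exp (- T - 1 / 2)\<close>, so that a smaller positive \<open>\<rho>\<close> lies inside
  every circle traced in \<open>y\<close> and the quotient is bounded.\<close>

definition source :: "real \<Rightarrow> real \<Rightarrow> real \<Rightarrow> real \<times> real \<Rightarrow> complex" where
  "source T c \<rho> = (\<lambda>(x, y). indicator {-1..1} x *\<^sub>R
     (exp (phase T c (0, x, y)) / (exp (phase T c (0, x, y)) - of_real \<rho>)))"

section \<open>Measurability and square integrability of the initial datum\<close>

lemma exp_phase_measurable [measurable]: "(\<lambda>p. exp (phase T c (t, p))) \<in> borel_measurable borel"
  unfolding phase_def case_prod_beta
  by (intro borel_measurable_continuous_onI continuous_intros) auto

lemma source_measurable: "source T c \<rho> \<in> borel_measurable borel"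
proof -
  have "(\<lambda>p::real\<times>real. indicator ({-1..1} \<times> UNIV) p *\<^sub>R
      (exp (phase T c (0, p)) / (exp (phase T c (0, p)) - of_real \<rho>))) \<in> borel_measurable borel"
  proof -
    have [measurable]: "({-1..1} \<times> UNIV :: (real \<times> real) set) \<in> sets borel" by (intro borel_Times) auto
    show ?thesis by measurable
  qed
  also have "(\<lambda>p::real\<times>real. indicator ({-1..1} \<times> UNIV) p *\<^sub>R
      (exp (phase T c (0, p)) / (exp (phase T c (0, p)) - of_real \<rho>))) = source T c \<rho>"
    by (auto simp: source_def fun_eq_iff split: split_indicator)
  finally show ?thesis .
qed

lemma norm_source_le:
  assumes "T > 0" "0 < \<rho>" "\<rho> < exp (- T - 1 / 2)"
  shows "norm (source T c \<rho> (x, y)) \<le> indicator {-1..1} x / (exp (- T - 1 / 2) - \<rho>)"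
proof (cases "x \<in> {-1..1}")
  case True
  let ?w = "exp (phase T c (0, x, y))"
  have x: "x\<^sup>2 \<le> 1" using True by (simp add: abs_square_le_1 abs_le_iff)
  have w: "norm ?w \<ge> exp (- T - 1 / 2)" "norm ?w \<le> 1"
  proof -
    have "- T - 1 / 2 \<le> 0 - T - x\<^sup>2 / 2" "0 - T - x\<^sup>2 / 2 \<le> 0"
      using x assms(1) zero_le_power2[of x] by linarith+
    then show "norm ?w \<ge> exp (- T - 1 / 2)" "norm ?w \<le> 1"
      unfolding norm_exp_phase by (simp_all only: exp_le_cancel_iff exp_le_one_iff)
  qed
  then have "norm (?w - of_real \<rho>) \<ge> exp (- T - 1 / 2) - \<rho>"
    using norm_triangle_ineq2[of ?w "of_real \<rho>"] assms(2) unfolding norm_of_real by linarith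
  then have "norm ?w / norm (?w - of_real \<rho>) \<le> 1 / (exp (- T - 1 / 2) - \<rho>)"
    using w assms(3) by (intro frac_le) auto
  then show ?thesis using True by (simp add: source_def norm_divide)
qed (simp add: source_def)

lemma indicator_strip_integrable:
  "integrable lborel (\<lambda>(x, y). indicator {-1..1} (x::real) * indicator {0..<2 * pi} (y::real) :: real)"
  by (rule integrable_lborel_prod_mult[OF integrable_indicator_lborel[of _ "-1" 1] integrable_indicator_lborel[of _ 0 "2 * pi"]]) auto

lemma source_in_L2:
  assumes "T > 0" "0 < \<rho>" "\<rho> < exp (- T - 1 / 2)"
  shows "source T c \<rho> \<in> L2 cyl"
proof -
  let ?C = "1 / (exp (- T - 1 / 2) - \<rho>)"
  have m: "source T c \<rho> \<in> borel_measurable cyl"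
    using source_measurable[of T c \<rho>] unfolding cyl_def by (intro measurable_restrict_space1) simp
  have "integrable lborel (\<lambda>p. indicator cyl_dom p *\<^sub>R (norm (source T c \<rho> p))\<^sup>2)"
  proof (rule Bochner_Integration.integrable_bound)
    show "integrable lborel (\<lambda>p. ?C\<^sup>2 * ((case p of (x, y) \<Rightarrow> indicator {-1..1} (x::real) * indicator {0..<2 * pi} y) :: real))"
      by (intro integrable_mult_right indicator_strip_integrable)
    show "(\<lambda>p. indicator cyl_dom p *\<^sub>R (norm (source T c \<rho> p))\<^sup>2) \<in> borel_measurable lborel"
      using source_measurable[of T c \<rho>] cyl_dom_measurable by simp
    have "indicator cyl_dom (x, y) * (norm (source T c \<rho> (x, y)))\<^sup>2
        \<le> ?C\<^sup>2 * (indicator {-1..1} x * indicator {0..<2 * pi} y)" for x y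
      using power_mono[OF norm_source_le[OF assms, of c x y], of 2]
      by (auto simp: cyl_dom_def power_divide split: split_indicator)
    then show "AE p in lborel. norm (indicator cyl_dom p *\<^sub>R (norm (source T c \<rho> p))\<^sup>2)
        \<le> norm (?C\<^sup>2 * ((case p of (x, y) \<Rightarrow> indicator {-1..1} (x::real) * indicator {0..<2 * pi} y) :: real))"
      by (intro AE_I2) (auto simp: abs_mult)
  qed
  then have "integrable cyl (\<lambda>p. (norm (source T c \<rho> p))\<^sup>2)"
    unfolding cyl_def using cyl_dom_measurable by (simp add: integrable_restrict_space)
  with m show ?thesis by (simp add: L2_def)
qed

lemma wave_measurable: "(\<lambda>p. wave q T c R (t, p)) \<in> borel_measurable borel"
proof -
  have "continuous_on UNIV (wave q T c R)"
    by (intro differentiable_imp_continuous_on)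
      (simp add: differentiable_on_def smooth_alg_differentiable wave_in_smooth_alg)
  then have "continuous_on UNIV (\<lambda>p. wave q T c R (t, p))"
    by (rule continuous_on_compose2) (auto intro!: continuous_intros)
  then show ?thesis by (rule borel_measurable_continuous_onI)
qed

lemma continuous_on_bump: "continuous_on A bump"
  by (meson DERIV_isCont bump_has_real_derivative continuous_at_imp_continuous_on)

text \<open>By Fubini, Cauchy's formula evaluates the integral over \<open>y\<close>, apart from the
  cutoff factor, to 2 pi times \<open>poly q (of_real \<rho>)\<close> for each \<open>x\<close> in
  [-1,1]. As \<open>R \<ge> 2\<close>, the cutoff is at least \<open>exp (- 4)\<close> there, and
  [-1,1] has length 2.\<close>

lemma source_wave_lower_bound:
  assumes "T > 0" "0 < \<rho>" "\<rho> < exp (- T - 1 / 2)" "R \<ge> 2"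
  shows "norm (LINT p|cyl. source T c \<rho> p * wave q T c R (0, p)) \<ge> 4 * pi * exp (- 4) * norm (poly q (of_real \<rho>))"
proof -
  let ?F = "\<lambda>p. indicator cyl_dom p *\<^sub>R (source T c \<rho> p * wave q T c R (0, p))"
  let ?C = "1 / (exp (- T - 1 / 2) - \<rho>)"
  let ?v = "2 * of_real pi * poly q (of_real \<rho> :: complex)"
  have C: "?C > 0" using assms by simp
  obtain B where B0: "B \<ge> 0" and B: "\<And>z. norm z \<le> 1 \<Longrightarrow> norm (poly q z) \<le> B"
    using poly_bounded_unit_disc[of q] by blast
  have wB: "norm (wave q T c R (0, x, y)) \<le> B" for x y
  proof -
    have "norm (exp (phase T c (0, x, y))) \<le> 1" using assms(1) by (intro norm_exp_phase_le_1) simp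
    then have "bump (x / R) * norm (poly q (exp (phase T c (0, x, y)))) \<le> 1 * B"
      using B bump_bounds by (intro mult_mono) auto
    then show ?thesis using bump_bounds by (simp add: wave_def norm_mult)
  qed
  have int: "integrable (lborel \<Otimes>\<^sub>M lborel) ?F"
    unfolding lborel_prod
  proof (rule Bochner_Integration.integrable_bound)
    show "integrable lborel (\<lambda>p. (?C * B) * ((case p of (x, y) \<Rightarrow> indicator {-1..1} (x::real) * indicator {0..<2 * pi} y) :: real))"
      by (intro integrable_mult_right indicator_strip_integrable)
    show "?F \<in> borel_measurable lborel"
      using source_measurable[of T c \<rho>] wave_measurable[of q T c R 0] cyl_dom_measurable by simp
    have "norm (?F (x, y)) \<le> (?C * B) * (indicator {-1..1} x * indicator {0..<2 * pi} y)" for x y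
    proof (cases "(x, y) \<in> cyl_dom")
      case True
      have "norm (source T c \<rho> (x, y)) * norm (wave q T c R (0, x, y)) \<le> (indicator {-1..1} x * ?C) * B"
        using norm_source_le[OF assms(1-3), of c x y] wB[of x y] C by (intro mult_mono) auto
      then show ?thesis using True by (simp add: norm_mult cyl_dom_def mult_ac)
    qed (use C B0 in simp)
    then show "AE p in lborel. norm (?F p)
        \<le> norm ((?C * B) * ((case p of (x, y) \<Rightarrow> indicator {-1..1} (x::real) * indicator {0..<2 * pi} y) :: real))"
      using C B0 by (intro AE_I2) (auto simp: abs_mult simp del: norm_scaleR)
  qed
  have inner: "(LINT y|lborel. ?F (x, y)) = (indicator {-1..1} x * bump (x / R)) *\<^sub>R ?v" for x
  proof (cases "x \<in> {-1..1}")
    case True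
    let ?w = "\<lambda>y. exp (phase T c (0, x, y))"
    have "x\<^sup>2 \<le> 1" using True by (simp add: abs_square_le_1 abs_le_iff)
    then have "exp (- T - 1 / 2) \<le> exp (- T - x\<^sup>2 / 2)" by simp
    with assms have \<rho>: "\<bar>\<rho>\<bar> < exp (- T - x\<^sup>2 / 2)" by linarith
    have F: "?F (x, y) = bump (x / R) *\<^sub>R (indicator {0..<2 * pi} y *\<^sub>R
        (?w y / (?w y - of_real \<rho>) * poly q (?w y)))" for y
      using True by (simp add: source_def wave_def cyl_dom_def scaleR_conv_of_real split: split_indicator)
    show ?thesis
      unfolding F integral_scaleR_right integral_cauchy_kernel_phase[OF \<rho>] using True by simp
  qed (simp add: source_def)
  have ib: "integrable lborel (\<lambda>x. indicator {-1..1} x * bump (x / R))"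
  proof -
    have "continuous_on {-1..1} (\<lambda>x. bump (x / R))"
      by (rule continuous_on_compose2[OF continuous_on_bump[of UNIV]])
        (use assms(4) in \<open>auto intro!: continuous_intros\<close>)
    from borel_integrable_atLeastAtMost'[OF this] show ?thesis
      by (simp only: set_integrable_def real_scaleR_def)
  qed
  have "(LINT p|cyl. source T c \<rho> p * wave q T c R (0, p)) = (LINT p|lborel. ?F p)"
    unfolding cyl_def using cyl_dom_measurable by (subst integral_restrict_space) auto
  also have "\<dots> = (LINT x|lborel. LINT y|lborel. ?F (x, y))"
    using lborel_pair.integral_fst'[OF int] by (simp add: lborel_prod)
  also have "\<dots> = (LINT x|lborel. indicator {-1..1} x * bump (x / R)) *\<^sub>R ?v"
    unfolding inner using ib by (rule integral_scaleR_left)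
  finally have J: "norm (LINT p|cyl. source T c \<rho> p * wave q T c R (0, p))
      = \<bar>LINT x|lborel. indicator {-1..1} x * bump (x / R)\<bar> * (2 * pi * norm (poly q (of_real \<rho>)))"
    by (simp add: norm_mult)
  have "(LINT x|lborel. indicator {-1..1} (x::real) * exp (- 4 :: real)) \<le> (LINT x|lborel. indicator {-1..1} x * bump (x / R))"
  proof (rule integral_mono[OF _ ib])
    show "indicator {-1..1} x * exp (- 4) \<le> indicator {-1..1} x * bump (x / R)" for x :: real
    proof (cases "x \<in> {-1..1}")
      case True
      then have "\<bar>x\<bar> \<le> 1" by auto
      then have "\<bar>x / R\<bar> \<le> 1 / 2" using assms(4) by (simp add: divide_le_eq)
      then show ?thesis using bump_ge by (simp add: mult_left_mono)
    qed simp
  qed (intro integrable_mult_left integrable_indicator_lborel[of _ "-1" 1], auto)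
  then have low: "2 * exp (- 4) \<le> (LINT x|lborel. indicator {-1..1} x * bump (x / R))" by simp
  have "2 * exp (- 4) * (2 * pi * norm (poly q (of_real \<rho>)))
      \<le> \<bar>LINT x|lborel. indicator {-1..1} x * bump (x / R)\<bar> * (2 * pi * norm (poly q (of_real \<rho>)))"
    using low by (intro mult_right_mono) auto
  then show ?thesis unfolding J by (simp add: mult_ac)
qed

subsection \<open>Observation and conclusion\<close>

text \<open>Divisibility by the variable, encoded by \<open>pCons 0 q\<close>, is what brings in the
  Gaussian decay in \<open>x\<close>.\<close>

lemma norm_wave_le:
  assumes "t \<le> T" and "norm (poly q (exp (phase T c (t, x, y)))) \<le> 1"
  shows "norm (wave (pCons 0 q) T c R (t, x, y)) \<le> exp (- x\<^sup>2 / 2)"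
proof -
  let ?w = "exp (phase T c (t, x, y))"
  have "bump (x / R) * (norm ?w * norm (poly q ?w)) \<le> 1 * (exp (- x\<^sup>2 / 2) * 1)"
    using norm_exp_phase_le[OF assms(1)] assms(2) bump_bounds by (intro mult_mono) auto
  then show ?thesis using bump_bounds by (simp add: wave_def norm_mult)
qed

text \<open>Every term contains a derivative of the cutoff, hence a factor 1 / R, while half of the
  Gaussian exponent absorbs the growth of \<open>x\<close>. As the constant is independent of
  \<open>R\<close>, the truncation error vanishes in the limit.\<close>

lemma grushin_adjoint_wave_bound:
  fixes q :: "complex poly" and T c :: real
  obtains C where "C \<ge> 0" and "\<And>R t x y. R \<ge> 1 \<Longrightarrow> t \<le> T \<Longrightarrow>
    norm (grushin_adjoint (wave (pCons 0 q) T c R) (t, x, y)) \<le> C / R * exp (- x\<^sup>2 / 4)"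
proof -
  obtain B1 where B1: "B1 \<ge> 0" "\<And>z. norm z \<le> 1 \<Longrightarrow> norm (poly q z) \<le> B1"
    using poly_bounded_unit_disc[of q] by blast
  obtain B2 where B2: "B2 \<ge> 0" "\<And>z. norm z \<le> 1 \<Longrightarrow> norm (poly (pderiv (pCons 0 q)) z) \<le> B2"
    using poly_bounded_unit_disc[of "pderiv (pCons 0 q)"] by blast
  obtain D where D: "\<And>s. \<bar>bump' s\<bar> \<le> D" "\<And>s. \<bar>bump'' s\<bar> \<le> D" using bump_derivs_bounded by blast
  have D0: "D \<ge> 0" using order_trans[OF abs_ge_zero D(1)[of 0]] .
  have "norm (grushin_adjoint (wave (pCons 0 q) T c R) (t, x, y)) \<le> (2 * D * B2 + D * B1) / R * exp (- x\<^sup>2 / 4)"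
    if R: "R \<ge> 1" and t: "t \<le> T" for R t x y
  proof -
    let ?w = "exp (phase T c (t, x, y))" and ?e = "exp (- x\<^sup>2 / 4)"
    have e: "norm ?w \<le> ?e * ?e" using norm_exp_phase_le[OF t, of c x y] by (simp flip: exp_add)
    have e1: "?e \<le> 1" by simp
    have "\<bar>x\<bar> \<le> 1 + x\<^sup>2 / 4"
      using zero_le_power2[of "\<bar>x\<bar> / 2 - 1"] by (simp add: power2_eq_square algebra_simps)
    also have "\<dots> \<le> exp (x\<^sup>2 / 4)" by (rule exp_ge_add_one_self)
    finally have "\<bar>x\<bar> * ?e \<le> exp (x\<^sup>2 / 4) * ?e" by (intro mult_right_mono) auto
    also have "\<dots> = 1" by (simp flip: exp_add)
    finally have xe: "\<bar>x\<bar> * ?e \<le> 1" .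
    have xw: "\<bar>x\<bar> * norm ?w \<le> ?e"
    proof -
      have "\<bar>x\<bar> * norm ?w \<le> (\<bar>x\<bar> * ?e) * ?e" using mult_left_mono[OF e, of "\<bar>x\<bar>"] by (simp add: mult_ac)
      also have "\<dots> \<le> 1 * ?e" using xe by (intro mult_right_mono) auto
      finally show ?thesis by simp
    qed
    have "?e * ?e \<le> ?e" using mult_right_mono[OF e1, of ?e] by (simp only: mult_1 exp_ge_zero)
    with e have w: "norm ?w \<le> ?e" by (rule order_trans)
    have w1: "norm ?w \<le> 1" by (rule norm_exp_phase_le_1[OF t])
    have 1: "norm (of_real (2 * x * bump' (x / R) / R) * (?w * poly (pderiv (pCons 0 q)) ?w))
        \<le> (2 * D * B2) / R * ?e"
    proof -
      have "norm (of_real (2 * x * bump' (x / R) / R) * (?w * poly (pderiv (pCons 0 q)) ?w))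
          = (\<bar>x\<bar> * norm ?w) * (2 / R * (\<bar>bump' (x / R)\<bar> * norm (poly (pderiv (pCons 0 q)) ?w)))"
        using R by (simp only: norm_mult norm_of_real abs_mult abs_divide) simp
      also have "\<dots> \<le> ?e * (2 / R * (D * B2))"
        using R D(1) B2(2)[OF w1] D0 B2(1) xw by (intro mult_mono order_refl) auto
      finally show ?thesis by (simp add: mult_ac)
    qed
    have 2: "norm (of_real (bump'' (x / R) / R\<^sup>2) * poly (pCons 0 q) ?w) \<le> (D * B1) / R * ?e"
    proof -
      have "R \<le> R\<^sup>2" using R by (simp add: power2_eq_square)
      then have "\<bar>bump'' (x / R)\<bar> / R\<^sup>2 \<le> D / R" using D(2) D0 R by (intro frac_le) auto
      moreover have "norm ?w * norm (poly q ?w) \<le> ?e * B1"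
        using w B1(2)[OF w1] by (intro mult_mono) auto
      ultimately have "(\<bar>bump'' (x / R)\<bar> / R\<^sup>2) * (norm ?w * norm (poly q ?w)) \<le> (D / R) * (?e * B1)"
        by (rule mult_mono) (use D0 R in \<open>auto\<close>)
      then show ?thesis by (simp add: norm_mult norm_divide norm_power mult_ac)
    qed
    show ?thesis
      unfolding grushin_adjoint_wave add_divide_distrib distrib_right
      by (rule order_trans[OF norm_triangle_ineq4 add_mono[OF 1 2]])
  qed
  then show ?thesis using D0 B1(1) B2(1) by (intro that[of "2 * D * B2 + D * B1"]) auto
qed

text \<open>The pointwise inequality 2 |f g| \<le> |f|^2 + |g|^2 takes the place of Cauchy-Schwarz;
  it suffices for uniform bounds.\<close>

lemma norm_integral_mult_le:
  fixes f g :: "'a \<Rightarrow> complex"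
  assumes "integrable M (\<lambda>p. (norm (f p))\<^sup>2)" "integrable M G"
    and "\<And>p. p \<in> space M \<Longrightarrow> (norm (g p))\<^sup>2 \<le> G p"
  shows "norm (LINT p|M. f p * g p) \<le> ((LINT p|M. (norm (f p))\<^sup>2) + (LINT p|M. G p)) / 2"
proof -
  have G: "0 \<le> G p" if "p \<in> space M" for p
    using order_trans[OF zero_le_power2 assms(3)[OF that]] .
  have "norm (f p * g p) \<le> ((norm (f p))\<^sup>2 + G p) / 2" if "p \<in> space M" for p
    using assms(3)[OF that] sum_squares_bound[of "norm (f p)" "norm (g p)"] by (simp add: norm_mult)
  \<comment> \<open>If the product is not integrable, its integral is 0 by convention, which the
    nonnegative majorant still bounds.\<close>
  then have "(LINT p|M. norm (f p * g p)) \<le> (LINT p|M. ((norm (f p))\<^sup>2 + G p) / 2)"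
    using assms G by (intro integral_mono') auto
  also have "\<dots> = ((LINT p|M. (norm (f p))\<^sup>2) + (LINT p|M. G p)) / 2"
    using assms by simp
  finally show ?thesis by (rule order_trans[OF integral_norm_bound])
qed

lemma le_of_le_add_inverse:
  fixes A B D :: real
  assumes "\<And>R. R \<ge> 2 \<Longrightarrow> A \<le> B + D / R"
  shows "A \<le> B"
proof (rule tendsto_lowerbound)
  show "((\<lambda>R. B + D / R) \<longlongrightarrow> B) at_top"
    using tendsto_add[OF tendsto_const tendsto_divide_0[OF tendsto_const filterlim_at_top_imp_at_infinity[OF filterlim_ident]], of B D]
    by simp
  show "\<forall>\<^sub>F R in at_top. A \<le> B + D / R"
    using eventually_ge_at_top[of 2] by eventually_elim (rule assms)
qed simp

text \<open>A control steering \<open>source T c \<rho>\<close> to rest would bound the values at \<open>\<rho>\<close> of all polynomials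
  that are bounded by 1 on the part of the disc swept by the control region.\<close>

lemma control_bounds_poly_values:
  fixes a b T \<rho> :: real
  defines "c \<equiv> (a + b) / 2" and "\<omega> \<equiv> UNIV \<times> (UNIV - torus_segment a b)"
  assumes T: "T > 0" and \<rho>: "0 < \<rho>" "\<rho> < exp (- T - 1 / 2)"
    and u: "u \<in> L2 (control_space T \<omega>)"
    and sol: "grushin_solution \<omega> T (source T c \<rho>) u f" and final: "AE p in cyl. f T p = 0"
  obtains B where "\<And>q. (\<And>t x y. t \<le> T \<Longrightarrow> y \<notin> torus_segment a b \<Longrightarrow>
      norm (poly q (exp (phase T c (t, x, y)))) \<le> 1) \<Longrightarrow> norm (poly q (of_real \<rho>)) \<le> B"
proof -
  let ?G = "LINT p|cyl. (case p of (x, y) \<Rightarrow> exp (- x\<^sup>2 / 2))"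
  \<comment> \<open>\<open>U\<close> depends on the control but not on the polynomial; this
    uniformity leads to the final contradiction.\<close>
  define U where "U = ((LINT p|control_space T \<omega>. (norm (u p))\<^sup>2)
    + (LINT p|control_space T \<omega>. (case p of (t, x, y) \<Rightarrow> exp (- x\<^sup>2 / 2)))) / 2"
  have V: "UNIV - torus_segment a b \<in> sets borel" using torus_segment_measurable[of a b] by auto
  have f: "continuous_L2 T cyl f" using sol by (simp add: grushin_solution_def)
  obtain N where N: "\<And>t. t \<in> {0..T} \<Longrightarrow> (LINT p|cyl. (norm (f t p))\<^sup>2) \<le> N"
    using continuous_L2_bounded[OF f] by blast
  \<comment> \<open>The constant of \<open>source_wave_lower_bound\<close>, times
    \<open>\<rho>\<close> as the value at \<open>\<rho>\<close> of the extra factor in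
    \<open>pCons 0 q\<close>.\<close>
  define k where "k = 4 * pi * exp (- 4) * \<rho>"
  have k: "k > 0" using \<rho> by (simp add: k_def)
  have "norm (poly q (of_real \<rho>)) \<le> U / k"
    if q: "\<And>t x y. t \<le> T \<Longrightarrow> y \<notin> torus_segment a b \<Longrightarrow> norm (poly q (exp (phase T c (t, x, y)))) \<le> 1" for q
  proof -
    let ?w = "\<lambda>R. wave (pCons 0 q) T c R"
    obtain C where C: "C \<ge> 0" "\<And>R t x y. R \<ge> 1 \<Longrightarrow> t \<le> T \<Longrightarrow>
        norm (grushin_adjoint (?w R) (t, x, y)) \<le> C / R * exp (- x\<^sup>2 / 4)"
      using grushin_adjoint_wave_bound[of T q c] by blast
    \<comment> \<open>\<open>D\<close> depends on \<open>q\<close> through \<open>C\<close>, but it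
      enters only as \<open>D / R\<close> and disappears as \<open>R\<close> grows.\<close>
    define D where "D = T * ((N + C\<^sup>2 * ?G) / 2)"
    have "k * norm (poly q (of_real \<rho>)) \<le> U + D / R" if R: "R \<ge> 2" for R
    proof -
      let ?E = "\<lambda>s p. grushin_adjoint (?w R) (s, p)"
      have "\<forall>t\<in>{0..T}. (LINT p|cyl. f t p * ?w R (t, p)) - (LINT p|cyl. source T c \<rho> p * ?w R (0, p))
          + (LINT s:{0..t}|lborel. (LINT p|cyl. f s p * ?E s p))
          = (LINT q|control_space t \<omega>. u q * ?w R q)"
        using sol test_function_wave[of R "pCons 0 q" T c] R unfolding grushin_solution_def by simp
      moreover have "T \<in> {0..T}" using T by simp
      ultimately have "(LINT p|cyl. f T p * ?w R (T, p)) - (LINT p|cyl. source T c \<rho> p * ?w R (0, p))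
          + (LINT s:{0..T}|lborel. (LINT p|cyl. f s p * ?E s p))
          = (LINT q|control_space T \<omega>. u q * ?w R q)" by blast
      moreover have "(LINT p|cyl. f T p * ?w R (T, p)) = 0"
        by (rule integral_eq_zero_AE) (use final in eventually_elim, simp)
      ultimately have duality: "(LINT p|cyl. source T c \<rho> p * ?w R (0, p))
          = (LINT s:{0..T}|lborel. (LINT p|cyl. f s p * ?E s p)) - (LINT q|control_space T \<omega>. u q * ?w R q)"
        by (simp add: algebra_simps)
      have control: "norm (LINT q|control_space T \<omega>. u q * ?w R q) \<le> U"
        unfolding U_def
      proof (rule norm_integral_mult_le)
        show "integrable (control_space T \<omega>) (\<lambda>p. (norm (u p))\<^sup>2)" using u by (simp add: L2_def)
        show "integrable (control_space T \<omega>) (\<lambda>p. case p of (t, x, y) \<Rightarrow> exp (- x\<^sup>2 / 2))"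
          unfolding \<omega>_def by (rule integrable_control_space_gaussian[OF V])
        fix p assume p: "p \<in> space (control_space T \<omega>)"
        obtain t x y where txy: "p = (t, x, y)" by (cases p)
        have ty: "t \<le> T" "y \<notin> torus_segment a b"
          using p by (auto simp: txy control_space_def space_restrict_space \<omega>_def)
        have le: "norm (?w R (t, x, y)) \<le> exp (- x\<^sup>2 / 2)" by (rule norm_wave_le[OF ty(1) q[OF ty]])
        have "norm (?w R (t, x, y)) \<le> 1" by (rule order_trans[OF le]) simp
        with le have "norm (?w R (t, x, y)) * norm (?w R (t, x, y)) \<le> exp (- x\<^sup>2 / 2) * 1"
          by (intro mult_mono) auto
        then have "(norm (?w R (t, x, y)))\<^sup>2 \<le> exp (- x\<^sup>2 / 2)"
          by (simp add: power2_eq_square[of "norm _"])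
        then show "(norm (?w R p))\<^sup>2 \<le> (case p of (t, x, y) \<Rightarrow> exp (- x\<^sup>2 / 2))" by (simp add: txy)
      qed
      have slice: "norm (LINT p|cyl. f s p * ?E s p) \<le> (N + C\<^sup>2 * ?G) / 2 / R" if s: "s \<in> {0..T}" for s
      proof -
        have Es: "norm (?E s p) \<le> C / R * (case p of (x, y) \<Rightarrow> exp (- x\<^sup>2 / 4))" for p
        proof -
          obtain x y where "p = (x, y)" by (cases p)
          then show ?thesis using C(2)[of R s x y] R s by simp
        qed
        \<comment> \<open>The factor \<open>R\<close> is put on the second function before the
          quadratic inequality is applied, so that the gain 1 / R survives.\<close>
        have "norm (LINT p|cyl. f s p * (of_real R * ?E s p))
            \<le> ((LINT p|cyl. (norm (f s p))\<^sup>2) + (LINT p|cyl. C\<^sup>2 * (case p of (x, y) \<Rightarrow> exp (- x\<^sup>2 / 2)))) / 2"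
        proof (rule norm_integral_mult_le)
          show "integrable cyl (\<lambda>p. (norm (f s p))\<^sup>2)" using f s by (auto simp: continuous_L2_def L2_def)
          show "integrable cyl (\<lambda>p. C\<^sup>2 * (case p of (x, y) \<Rightarrow> exp (- x\<^sup>2 / 2)))"
            by (intro integrable_mult_right integrable_cyl_gaussian)
          fix p :: "real \<times> real"
          obtain x y where xy: "p = (x, y)" by (cases p)
          have "norm (of_real R * ?E s p) \<le> C * exp (- x\<^sup>2 / 4)"
            using mult_left_mono[OF Es[of p], of R] R by (simp add: norm_mult xy)
          from power_mono[OF this, of 2]
          have "(norm (of_real R * ?E s p))\<^sup>2 \<le> C\<^sup>2 * (exp (- x\<^sup>2 / 4))\<^sup>2" by (simp add: power_mult_distrib)
          also have "(exp (- x\<^sup>2 / 4))\<^sup>2 = exp (- x\<^sup>2 / 2)" by (simp flip: exp_double)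
          finally show "(norm (of_real R * ?E s p))\<^sup>2 \<le> C\<^sup>2 * (case p of (x, y) \<Rightarrow> exp (- x\<^sup>2 / 2))"
            by (simp add: xy)
        qed
        also have "(LINT p|cyl. C\<^sup>2 * (case p of (x, y) \<Rightarrow> exp (- x\<^sup>2 / 2))) = C\<^sup>2 * ?G"
          by (rule integral_mult_right_zero)
        also have "(LINT p|cyl. f s p * (of_real R * ?E s p)) = of_real R * (LINT p|cyl. f s p * ?E s p)"
          by (simp add: mult.left_commute)
        finally show ?thesis using N[OF s] R by (simp add: norm_mult field_simps)
      qed
      have "norm (LINT s:{0..T}|lborel. (LINT p|cyl. f s p * ?E s p))
          \<le> (LINT s|lborel. norm (indicator {0..T} s *\<^sub>R (LINT p|cyl. f s p * ?E s p)))"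
        unfolding set_lebesgue_integral_def by (rule integral_norm_bound)
      \<comment> \<open>The default value 0 of a nonintegrable integral again helps: only a
        pointwise bound in \<open>s\<close> is at hand.\<close>
      also have "\<dots> \<le> (LINT s|lborel. indicator {0..T} s * ((N + C\<^sup>2 * ?G) / 2 / R))"
      proof (rule integral_mono')
        show "integrable lborel (\<lambda>s. indicator {0..T} s * ((N + C\<^sup>2 * ?G) / 2 / R))"
          by (intro integrable_mult_left integrable_indicator_lborel[of _ 0 T]) auto
        show le: "norm (indicator {0..T} s *\<^sub>R (LINT p|cyl. f s p * ?E s p)) \<le> indicator {0..T} s * ((N + C\<^sup>2 * ?G) / 2 / R)" for s
          using slice[of s] by (cases "s \<in> {0..T}") auto
        show "0 \<le> indicator {0..T} s * ((N + C\<^sup>2 * ?G) / 2 / R)" for s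
          by (rule order_trans[OF norm_ge_zero le])
      qed
      also have "\<dots> = D / R" using T by (simp add: D_def)
      finally have error: "norm (LINT s:{0..T}|lborel. (LINT p|cyl. f s p * ?E s p)) \<le> D / R" .
      have "k * norm (poly q (of_real \<rho>)) = 4 * pi * exp (- 4) * norm (poly (pCons 0 q) (of_real \<rho>))"
        using \<rho> by (simp add: k_def norm_mult)
      also have "\<dots> \<le> norm (LINT p|cyl. source T c \<rho> p * ?w R (0, p))"
        by (rule source_wave_lower_bound[OF T \<rho> R])
      also have "\<dots> \<le> D / R + U"
        unfolding duality by (rule order_trans[OF norm_triangle_ineq4 add_mono[OF error control]])
      finally show ?thesis by simp
    qed
    then have "k * norm (poly q (of_real \<rho>)) \<le> U" by (rule le_of_le_add_inverse)
    then show ?thesis using k by (simp add: field_simps)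
  qed
  then show ?thesis using that by blast
qed

theorem mainTheorem4:
  fixes a b T :: real
  assumes "a < b"
    and "T > 0"
  shows "\<not> grushin_null_controllable (UNIV \<times> (UNIV - torus_segment a b)) T"
proof
  assume ctrl: "grushin_null_controllable (UNIV \<times> (UNIV - torus_segment a b)) T"
  define c where "c = (a + b) / 2"
  \<comment> \<open>Half of the smallest modulus that the exponential of the phase attains at time 0
    over [-1,1].\<close>
  define \<rho> where "\<rho> = exp (- T - 1 / 2) / 2"
  have \<rho>: "0 < \<rho>" "\<rho> < exp (- T - 1 / 2)" by (simp_all add: \<rho>_def)
  have "exp (- T - 1 / 2) < 1" using assms(2) by simp
  then have \<rho>1: "\<rho> < 1" using \<rho> by linarith
  obtain \<kappa> where \<kappa>: "0 \<le> \<kappa>" "\<kappa> < 1"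
    and sector: "\<And>t x y. y \<notin> torus_segment a b \<Longrightarrow>
      Re (exp (phase T c (t, x, y))) \<le> \<kappa> * norm (exp (phase T c (t, x, y)))"
    using exp_phase_outside_sector[OF assms(1)] unfolding c_def by metis
  obtain P where P: "norm (poly P (of_real \<rho> :: complex)) > 1"
    and Pb: "\<And>z. norm z \<le> 1 \<Longrightarrow> Re z \<le> \<kappa> * norm z \<Longrightarrow> norm (poly P z) \<le> 1"
    using ex_poly_peak_outside_sector[OF \<kappa> \<rho>(1) \<rho>1] by blast
  obtain u f where uf: "u \<in> L2 (control_space T (UNIV \<times> (UNIV - torus_segment a b)))"
    "grushin_solution (UNIV \<times> (UNIV - torus_segment a b)) T (source T c \<rho>) u f"
    "AE p in cyl. f T p = 0"
    using ctrl source_in_L2[OF assms(2) \<rho>, of c] unfolding grushin_null_controllable_def by blast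
  obtain B where B: "\<And>q. (\<And>t x y. t \<le> T \<Longrightarrow> y \<notin> torus_segment a b \<Longrightarrow>
      norm (poly q (exp (phase T c (t, x, y)))) \<le> 1) \<Longrightarrow> norm (poly q (of_real \<rho>)) \<le> B"
    using control_bounds_poly_values[OF assms(2) \<rho> uf[unfolded c_def]] unfolding c_def by blast
  \<comment> \<open>All powers of \<open>P\<close> are bounded by 1 on the unit disc off the sector,
    so the same \<open>B\<close> bounds their values at \<open>\<rho>\<close>, which grow
    geometrically.\<close>
  have "norm (poly P (of_real \<rho>)) ^ n \<le> B" for n
  proof -
    have "norm (poly (P ^ n) (exp (phase T c (t, x, y)))) \<le> 1"
      if "t \<le> T" "y \<notin> torus_segment a b" for t x y
      using Pb[OF norm_exp_phase_le_1[OF that(1)] sector[OF that(2)]]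
      by (simp add: norm_power power_le_one)
    from B[OF this] show ?thesis by (simp add: norm_power)
  qed
  moreover obtain n where "norm (poly P (of_real \<rho>)) ^ n > B" using real_arch_pow[OF P] by blast
  ultimately show False by (meson not_le)
qed

end
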